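(* Let $\mathcal{D}$ be a data universe (as in the context), let $f:\mathcal{D}\to\mathbb{R}^2$ be arbitrary with query access taking time $T(n)$ on databases with $n$ entries, and let $\{\Delta_i\}$ be non-negative parameters. Let $g:\mathcal{D}\to\mathbb{R}^2$ be the 2-dimensional Sensitivity-Preprocessing Function of $f$ with parameters $\{\Delta_i\}$. Then $g(D)$ can be computed in time $O((T(n)+n)2^n)$ for any database $D$ with $n$ entries, $\Delta_i(g)\le\Delta_i$ for all $i$, and for any $D=(x_1,\dots,x_n)$, \[ \|f(D)-g(D)\|_1\le \max_{\sigma\in\sigma_D}\sum_{i=1}^{|D|}\max\left\{\left\|f(D_{\sigma(<i)}+x_{\sigma(i)})-f(D_{\sigma(<i)})\right\|_1-\Delta_{\sigma(i)},\,0\right\}, \] where $\sigma_D$ is the set of permutations of $[n]$ and $D_{\sigma(<i)}=(x_{\sigma(1)},\dots,x_{\sigma(i-1)})$.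
   Context: There is a (possibly infinite) collection of individuals; a database $D$ is a finite set of data records, one per individual in some finite set (write $i\in D$ if individual $i$'s record is in $D$). The data universe $\mathcal{D}$ contains $\emptyset$ and is closed under subsets. $D-x_i$ removes individual $i$'s record; $D+x_i$ adds a record $x_i$ of individual $i\notin D$. For $h:\mathcal{D}\to\mathbb{R}^2$, $\Delta_i(h)=\sup_{x_i,\,D:\,i\notin D}\|h(D)-h(D+x_i)\|_1$. For $y\in\mathbb{R}^2$ and $\Delta\ge0$, $(y,\Delta)^2_1=\{x\in\mathbb{R}^2:\|x-y\|_1\le\Delta\}$. The 2-dimensional Sensitivity-Preprocessing Function $g$ of $f$ with parameters $\{\Delta_i\}$ is defined recursively by $g(\emptyset)=f(\emptyset)$ and, for nonempty $D$, $g(D)$ is the point of $\bigcap_{i\in D}(g(D-x_i),\Delta_i)^2_1$ closest to $f(D)$ in the $\ell_2$ metric.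
   Formalization: The running-time claim assumes that the query time T(n) is non-decreasing in n; without this the stated bound fails, since g(D) depends on f at smaller databases whose queries could cost far more than T(n). *)

theory Defs
  imports
    "HOL-Analysis.Analysis"
    "HOL-Library.Finite_Map"
    "HOL-Library.Landau_Symbols"
    "HOL-Combinatorics.Permutations"
begin

section \<open>Databases and sensitivity\<close>

text \<open>A database is a finite partial map from individuals to records, so that it holds at most one
  record per individual: removing the record of \<open>i\<close> is \<^term>\<open>fmdrop i D\<close>, adding a
  record \<open>x\<close> of an individual \<open>i\<close> that is not in \<open>D\<close> is \<^term>\<open>fmupd i x D\<close>, and
  \<open>i \<in> D\<close> reads \<^term>\<open>i \<in> fmdom' D\<close>. Functions on a data universe are represented by total
  functions whose values outside the universe are never used.\<close>

type_synonym ('i, 'r) database = "('i, 'r) fmap"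

definition data_universe :: "('i, 'r) database set \<Rightarrow> bool" where
  "data_universe U \<longleftrightarrow> fmempty \<in> U \<and> (\<forall>D\<in>U. \<forall>D'. D' \<subseteq>\<^sub>f D \<longrightarrow> D' \<in> U)"

definition l1norm :: "real ^ 'n \<Rightarrow> real" where
  "l1norm x = (\<Sum>j\<in>UNIV. \<bar>x $ j\<bar>)"

definition l1ball :: "real ^ 'n \<Rightarrow> real \<Rightarrow> (real ^ 'n) set" where
  "l1ball y r = {x. l1norm (x - y) \<le> r}"

text \<open>The supremum is taken in the extended non-negative reals: it is \<open>\<infinity>\<close> if the differences are
  unbounded and \<open>0\<close> if the universe has no pair of the required form.\<close>

definition sensitivity ::
    "('i, 'r) database set \<Rightarrow> (('i, 'r) database \<Rightarrow> real ^ 2) \<Rightarrow> 'i \<Rightarrow> ennreal" where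
  "sensitivity U h i =
     (SUP (D, x) \<in> {(D, x). D \<in> U \<and> i \<notin> fmdom' D \<and> fmupd i x D \<in> U}.
        ennreal (l1norm (h D - h (fmupd i x D))))"


section \<open>The two-dimensional Sensitivity-Preprocessing Function\<close>

text \<open>\<^const>\<open>closest_point\<close> refers to the Euclidean metric of \<^typ>\<open>real ^ 2\<close>. On an empty set it
  would be an unspecified point.\<close>

function sens_preproc ::
    "(('i, 'r) database \<Rightarrow> real ^ 2) \<Rightarrow> ('i \<Rightarrow> real) \<Rightarrow> ('i, 'r) database \<Rightarrow> real ^ 2" where
  "sens_preproc f \<Delta> D =
     (if D = fmempty then f fmempty
      else closest_point (\<Inter>i\<in>fmdom' D. l1ball (sens_preproc f \<Delta> (fmdrop i D)) (\<Delta> i)) (f D))"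
  by pat_completeness auto
termination
proof (relation "Wellfounded.measure (\<lambda>(f, \<Delta>, D). card (fmdom' D))", goal_cases)
  case (2 f \<Delta> D i)
  then show ?case using card_Diff1_less[of "fmdom' D" i] by simp
qed simp

declare sens_preproc.simps [simp del]


section \<open>Error bound\<close>

text \<open>A database \<open>(x\<^sub>1, \<dots>, x\<^sub>n)\<close> is listed as \<open>xs = [(i\<^sub>1, x\<^sub>1), \<dots>, (i\<^sub>n, x\<^sub>n)]\<close> with distinct
  individuals. Positions are counted from \<open>0\<close>.\<close>

definition prefix_db :: "('i \<times> 'r) list \<Rightarrow> (nat \<Rightarrow> nat) \<Rightarrow> nat \<Rightarrow> ('i, 'r) database" where
  "prefix_db xs \<sigma> k = fmap_of_list (map (\<lambda>j. xs ! \<sigma> j) [0..<k])"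

definition path_error ::
    "(('i, 'r) database \<Rightarrow> real ^ 2) \<Rightarrow> ('i \<Rightarrow> real) \<Rightarrow> ('i \<times> 'r) list \<Rightarrow> (nat \<Rightarrow> nat) \<Rightarrow> real"
  where
  "path_error f \<Delta> xs \<sigma> =
     (\<Sum>k<length xs.
        let (i, x) = xs ! \<sigma> k; D = prefix_db xs \<sigma> k
        in max (l1norm (f (fmupd i x D) - f D) - \<Delta> i) 0)"


section \<open>Real-RAM programs with query access to a function on databases\<close>

text \<open>Time is measured on a unit-cost real RAM, programmed in a while language. The memory consists
  of arrays of natural numbers and arrays of reals; a scalar is entry \<open>0\<close> of an array. As a
  program mentions only finitely many array names, this amounts to two linear memories. Natural
  numbers serve as addresses and counters and only support addition, truncated subtraction and
  comparison. Reals support the field operations and comparison; they cannot be converted to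
  natural numbers, and the only real literals are integers.

  Individuals and records are opaque: a program refers to a record of its input through its
  position. To query the function, it assembles a database record by record in a query buffer.\<close>

type_synonym vname = string

datatype nexp =
    NConst nat
  | NRead vname nexp
  | NAdd nexp nexp
  | NSub nexp nexp

datatype rexp =
    RConst int
  | RRead vname nexp
  | RAdd rexp rexp
  | RSub rexp rexp
  | RMul rexp rexp
  | RDiv rexp rexp

datatype bexp =
    NLess nexp nexp
  | RLess rexp rexp
  | BNot bexp
  | BAnd bexp bexp

datatype com =
    Skip
  | NWrite vname nexp nexp
  | RWrite vname nexp rexp
  | ClearBuffer
  | InsertRecord nexp
  | Query vname
  | Seq com com
  | Cond bexp com com
  | While bexp com

record ('i, 'r) state =
  nmem :: "vname \<Rightarrow> nat \<Rightarrow> nat"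
  rmem :: "vname \<Rightarrow> nat \<Rightarrow> real"
  buffer :: "('i, 'r) database"

primrec nval :: "('i, 'r) state \<Rightarrow> nexp \<Rightarrow> nat" where
  "nval s (NConst k) = k"
| "nval s (NRead v e) = nmem s v (nval s e)"
| "nval s (NAdd a b) = nval s a + nval s b"
| "nval s (NSub a b) = nval s a - nval s b"

primrec rval :: "('i, 'r) state \<Rightarrow> rexp \<Rightarrow> real" where
  "rval s (RConst k) = of_int k"
| "rval s (RRead v e) = rmem s v (nval s e)"
| "rval s (RAdd a b) = rval s a + rval s b"
| "rval s (RSub a b) = rval s a - rval s b"
| "rval s (RMul a b) = rval s a * rval s b"
| "rval s (RDiv a b) = rval s a / rval s b"

primrec bval :: "('i, 'r) state \<Rightarrow> bexp \<Rightarrow> bool" where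
  "bval s (NLess a b) \<longleftrightarrow> nval s a < nval s b"
| "bval s (RLess a b) \<longleftrightarrow> rval s a < rval s b"
| "bval s (BNot b) \<longleftrightarrow> \<not> bval s b"
| "bval s (BAnd a b) \<longleftrightarrow> bval s a \<and> bval s b"

text \<open>Evaluating an expression takes one step per node.\<close>

primrec ncost :: "nexp \<Rightarrow> nat" where
  "ncost (NConst k) = 1"
| "ncost (NRead v e) = 1 + ncost e"
| "ncost (NAdd a b) = 1 + ncost a + ncost b"
| "ncost (NSub a b) = 1 + ncost a + ncost b"

primrec rcost :: "rexp \<Rightarrow> nat" where
  "rcost (RConst k) = 1"
| "rcost (RRead v e) = 1 + ncost e"
| "rcost (RAdd a b) = 1 + rcost a + rcost b"
| "rcost (RSub a b) = 1 + rcost a + rcost b"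
| "rcost (RMul a b) = 1 + rcost a + rcost b"
| "rcost (RDiv a b) = 1 + rcost a + rcost b"

primrec bcost :: "bexp \<Rightarrow> nat" where
  "bcost (NLess a b) = 1 + ncost a + ncost b"
| "bcost (RLess a b) = 1 + rcost a + rcost b"
| "bcost (BNot b) = 1 + bcost b"
| "bcost (BAnd a b) = 1 + bcost a + bcost b"

definition nwrite :: "vname \<Rightarrow> nat \<Rightarrow> nat \<Rightarrow> ('i, 'r) state \<Rightarrow> ('i, 'r) state" where
  "nwrite v k x s = s\<lparr>nmem := (nmem s)(v := (nmem s v)(k := x))\<rparr>"

definition rwrite :: "vname \<Rightarrow> nat \<Rightarrow> real \<Rightarrow> ('i, 'r) state \<Rightarrow> ('i, 'r) state" where
  "rwrite v k x s = s\<lparr>rmem := (rmem s)(v := (rmem s v)(k := x))\<rparr>"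

text \<open>\<open>exec T f xs c s t s'\<close>: with input records \<open>xs\<close> and query access to \<open>f\<close>, where a query on
  a database with \<open>n\<close> entries takes time \<open>T n\<close>, the command \<open>c\<close> started in \<open>s\<close> terminates
  in \<open>s'\<close> after \<open>t\<close> steps. A reference to a record beyond the input blocks the execution.\<close>

inductive exec ::
    "(nat \<Rightarrow> nat) \<Rightarrow> (('i, 'r) database \<Rightarrow> real ^ 2) \<Rightarrow> ('i \<times> 'r) list \<Rightarrow>
     com \<Rightarrow> ('i, 'r) state \<Rightarrow> nat \<Rightarrow> ('i, 'r) state \<Rightarrow> bool"
  for T f xs where
  Skip: "exec T f xs Skip s 1 s"
| NWrite: "exec T f xs (NWrite v a e) s (1 + ncost a + ncost e)
     (nwrite v (nval s a) (nval s e) s)"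
| RWrite: "exec T f xs (RWrite v a e) s (1 + ncost a + rcost e)
     (rwrite v (nval s a) (rval s e) s)"
| ClearBuffer: "exec T f xs ClearBuffer s 1 (s\<lparr>buffer := fmempty\<rparr>)"
| InsertRecord: "nval s a < length xs \<Longrightarrow> xs ! nval s a = (i, x) \<Longrightarrow>
     exec T f xs (InsertRecord a) s (1 + ncost a) (s\<lparr>buffer := fmupd i x (buffer s)\<rparr>)"
| Query: "exec T f xs (Query v) s (1 + T (card (fmdom' (buffer s))))
     (rwrite v 0 (f (buffer s) $ 1) (rwrite v 1 (f (buffer s) $ 2) s))"
| Seq: "exec T f xs c\<^sub>1 s t\<^sub>1 s' \<Longrightarrow> exec T f xs c\<^sub>2 s' t\<^sub>2 s'' \<Longrightarrow>
     exec T f xs (Seq c\<^sub>1 c\<^sub>2) s (t\<^sub>1 + t\<^sub>2) s''"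
| CondTrue: "bval s b \<Longrightarrow> exec T f xs c\<^sub>1 s t s' \<Longrightarrow>
     exec T f xs (Cond b c\<^sub>1 c\<^sub>2) s (1 + bcost b + t) s'"
| CondFalse: "\<not> bval s b \<Longrightarrow> exec T f xs c\<^sub>2 s t s' \<Longrightarrow>
     exec T f xs (Cond b c\<^sub>1 c\<^sub>2) s (1 + bcost b + t) s'"
| WhileFalse: "\<not> bval s b \<Longrightarrow> exec T f xs (While b c) s (1 + bcost b) s"
| WhileTrue: "bval s b \<Longrightarrow> exec T f xs c s t\<^sub>1 s' \<Longrightarrow> exec T f xs (While b c) s' t\<^sub>2 s'' \<Longrightarrow>
     exec T f xs (While b c) s (1 + bcost b + t\<^sub>1 + t\<^sub>2) s''"

text \<open>Executions are deterministic, so the time and the result of a terminating run are unique.\<close>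

lemma exec_deterministic:
  "exec T f xs c s t s' \<Longrightarrow> exec T f xs c s u s'' \<Longrightarrow> t = u \<and> s' = s''"
proof (induction arbitrary: u s'' rule: exec.induct)
  case (InsertRecord s a i x)
  from InsertRecord.prems InsertRecord.hyps show ?case by cases simp_all
next
  case (Seq c\<^sub>1 s t\<^sub>1 s' c\<^sub>2 t\<^sub>2 s2)
  from Seq.prems obtain u\<^sub>1 r u\<^sub>2 where
    "exec T f xs c\<^sub>1 s u\<^sub>1 r" "exec T f xs c\<^sub>2 r u\<^sub>2 s''" "u = u\<^sub>1 + u\<^sub>2"
    by cases
  with Seq.IH show ?case by metis
next
  case (CondTrue s b c\<^sub>1 t s' c\<^sub>2)
  from CondTrue.prems CondTrue.hyps obtain v where
    "exec T f xs c\<^sub>1 s v s''" "u = 1 + bcost b + v"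
    by cases simp_all
  with CondTrue.IH show ?case by metis
next
  case (CondFalse s b c\<^sub>2 t s' c\<^sub>1)
  from CondFalse.prems CondFalse.hyps obtain v where
    "exec T f xs c\<^sub>2 s v s''" "u = 1 + bcost b + v"
    by cases simp_all
  with CondFalse.IH show ?case by metis
next
  case (WhileFalse s b c)
  from WhileFalse.prems WhileFalse.hyps show ?case by cases simp_all
next
  case (WhileTrue s b c t\<^sub>1 s' t\<^sub>2 s2)
  from WhileTrue.prems WhileTrue.hyps(1) obtain u\<^sub>1 r u\<^sub>2 where
    "exec T f xs c s u\<^sub>1 r" "exec T f xs (While b c) r u\<^sub>2 s''" "u = 1 + bcost b + u\<^sub>1 + u\<^sub>2"
    by cases simp_all
  with WhileTrue.IH show ?case by metis
qed (erule exec.cases; simp; fail)+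

text \<open>Input: the number \<open>n\<close> of records in \<open>n[0]\<close> and the parameter of the individual owning the
  \<open>j\<close>-th record in \<open>Delta[j]\<close>, for \<open>j < n\<close>; everything else is zero. Output: the two
  coordinates in \<open>out[0]\<close> and \<open>out[1]\<close>.\<close>

definition initial_state :: "('i \<Rightarrow> real) \<Rightarrow> ('i \<times> 'r) list \<Rightarrow> ('i, 'r) state" where
  "initial_state \<Delta> xs = \<lparr>
     nmem = (\<lambda>v k. if v = ''n'' \<and> k = 0 then length xs else 0),
     rmem = (\<lambda>v k. if v = ''Delta'' \<and> k < length xs then \<Delta> (fst (xs ! k)) else 0),
     buffer = fmempty\<rparr>"

definition computes_within ::
    "(nat \<Rightarrow> nat) \<Rightarrow> (('i, 'r) database \<Rightarrow> real ^ 2) \<Rightarrow> ('i \<Rightarrow> real) \<Rightarrow> com \<Rightarrow>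
     ('i \<times> 'r) list \<Rightarrow> real ^ 2 \<Rightarrow> nat \<Rightarrow> bool" where
  "computes_within T f \<Delta> p xs y m \<longleftrightarrow>
     (\<exists>t s. exec T f xs p (initial_state \<Delta> xs) t s \<and> t \<le> m \<and>
        rmem s ''out'' 0 = y $ 1 \<and> rmem s ''out'' 1 = y $ 2)"

end

theory Submission
  imports Defs
begin

text \<open>In the coordinates \<open>u = x\<^sub>1 + x\<^sub>2\<close>, \<open>v = x\<^sub>1 - x\<^sub>2\<close> the \<open>\<ell>\<^sub>1\<close> norm is the maximum norm and the
  \<open>\<ell>\<^sub>2\<close> norm is the Euclidean one up to a factor. Hence \<open>\<ell>\<^sub>1\<close> balls are boxes, which intersect as
  soon as they intersect pairwise, and the closest point of their intersection is obtained by
  clamping each coordinate to an interval. Two of the balls defining \<open>g(D)\<close>, centred at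
  \<open>g(D - x\<^sub>i)\<close> and \<open>g(D - x\<^sub>j)\<close>, intersect because both centres are close to
  \<open>g(D - x\<^sub>i - x\<^sub>j)\<close>; this bounds the sensitivity. Clamping moves \<open>f(D)\<close> by at most
  \<open>max (\<parallel>f(D) - g(D - x\<^sub>i)\<parallel>\<^sub>1 - \<Delta>\<^sub>i) 0\<close> for some \<open>i\<close>, and taking that \<open>i\<close> as the last element of the
  permutation gives the error bound by induction. Finally, clamping to an intersection of intervals
  amounts to clamping to them one after the other, so that a dynamic program over the subsets of
  \<open>D\<close> spends one query and \<open>O(n)\<close> further steps on each of them.\<close>

section \<open>Intersections of balls\<close>

definition coord_sum :: "real ^ 2 \<Rightarrow> real" where
  "coord_sum z = z $ 1 + z $ 2"

definition coord_diff :: "real ^ 2 \<Rightarrow> real" where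
  "coord_diff z = z $ 1 - z $ 2"

lemma linear_coord_sum: "linear coord_sum" and linear_coord_diff: "linear coord_diff"
  by (simp_all add: linear_iff coord_sum_def coord_diff_def algebra_simps)

lemma coord_sum_diff: "coord_sum (x - y) = coord_sum x - coord_sum y"
  and coord_diff_diff: "coord_diff (x - y) = coord_diff x - coord_diff y"
  by (simp_all add: coord_sum_def coord_diff_def)

lemma l1norm_eq_max: "l1norm z = max \<bar>coord_sum z\<bar> \<bar>coord_diff z\<bar>"
  by (simp add: l1norm_def coord_sum_def coord_diff_def UNIV_2)

lemma norm_eq_coord_sum_coord_diff: "norm z = sqrt (((coord_sum z)\<^sup>2 + (coord_diff z)\<^sup>2) / 2)"
  by (simp add: norm_eq_sqrt_inner inner_vec_def UNIV_2 coord_sum_def coord_diff_def power2_eq_square field_simps)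

text \<open>The two coordinates take every pair of values at exactly one point, so points can be
  specified through them.\<close>

lemma eq_vector2_iff: "z = vector [(a + b) / 2, (a - b) / 2] \<longleftrightarrow> coord_sum z = a \<and> coord_diff z = b"
  for z :: "real ^ 2"
  by (auto simp: vec_eq_iff forall_2 coord_sum_def coord_diff_def field_simps)

lemma l1norm_triangle: "l1norm (x - z) \<le> l1norm (x - y) + l1norm (y - z)"
  for x y z :: "real ^ 'n"
  unfolding l1norm_def sum.distrib[symmetric] by (intro sum_mono) simp

lemma l1norm_commute: "l1norm (x - y) = l1norm (y - x)"
  for x y :: "real ^ 'n"
  by (simp add: l1norm_def abs_minus_commute)

text \<open>If the closest point \<open>y\<close> of \<open>I\<close> misses \<open>[a, b]\<close>,
  then \<open>x\<close> lies at \<open>y\<close> or beyond it, since otherwise points of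
  \<open>I\<close> on the way from \<open>y\<close> to the intersection would be nearer to
  \<open>x\<close>. So the end of \<open>[a, b]\<close> that faces \<open>y\<close> is the nearest
  remaining point.\<close>

lemma closest_point_Int_Icc:
  fixes I :: "real set"
  assumes "closed I" "convex I" "I \<inter> {a..b} \<noteq> {}"
  shows "closest_point (I \<inter> {a..b}) x = max a (min b (closest_point I x))"
proof -
  define y where "y = closest_point I x"
  have I: "I \<noteq> {}" using assms(3) by blast
  have yI: "y \<in> I" using assms(1) I closest_point_in_set y_def by blast
  have near: "\<bar>x - y\<bar> \<le> \<bar>x - w\<bar>" if "w \<in> I" for w
    using closest_point_le[OF assms(1) that, of x] by (simp add: y_def dist_real_def)
  obtain w where w: "w \<in> I" "a \<le> w" "w \<le> b" using assms(3) by auto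
  have ivl: "z \<in> I" if "y \<le> z \<and> z \<le> w \<or> w \<le> z \<and> z \<le> y" for z
    using assms(2) yI w(1) that by (metis is_interval_1 is_interval_convex_1)
  \<comment> \<open>Clamping moves \<open>y\<close> towards \<open>w\<close> without passing it, so
    convexity keeps the result in \<open>I\<close>.\<close>
  have "max a (min b y) \<in> I \<inter> {a..b}"
    using ivl[of "max a (min b y)"] yI w by (auto simp: max_def min_def not_le split: if_splits)
  moreover have "\<bar>x - max a (min b y)\<bar> \<le> \<bar>x - z\<bar>" if z: "z \<in> I \<inter> {a..b}" for z
  proof -
    have zi: "z' \<in> I" if "y \<le> z' \<and> z' \<le> z \<or> z \<le> z' \<and> z' \<le> y" for z'
      using assms(2) yI z that by (metis IntD1 is_interval_1 is_interval_convex_1)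
    \<comment> \<open>If \<open>y < x\<close>, then \<open>min x z\<close> lies between
      \<open>y\<close> and \<open>z\<close>, hence in \<open>I\<close>, and is nearer to
      \<open>x\<close> than \<open>y\<close>.\<close>
    have 1: "x \<le> y" if "y < z"
      using near[of "min x z"] zi[of "min x z"] that by (cases "y < x") (auto simp: min_def split: if_splits)
    have 2: "y \<le> x" if "z < y"
      using near[of "max x z"] zi[of "max x z"] that by (cases "x < y") (auto simp: max_def split: if_splits)
    consider "y < a" | "b < y" | "a \<le> y" "y \<le> b" by linarith
    then show ?thesis
    proof cases
      case 1
      then have "max a (min b y) = a" using w by simp
      then show ?thesis using 1 \<open>y < z \<Longrightarrow> x \<le> y\<close> z by simp
    next
      case 2
      then have "max a (min b y) = b" using w by simp
      then show ?thesis using 2 \<open>z < y \<Longrightarrow> y \<le> x\<close> z by simp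
    next
      case 3
      then have "max a (min b y) = y" by simp
      then show ?thesis using near z by simp
    qed
  qed
  ultimately show ?thesis
    using closest_point_unique[of "I \<inter> {a..b}" "max a (min b y)" x] assms(1,2)
    by (auto simp: y_def dist_real_def closed_Int convex_Int)
qed

lemma closest_point_Icc:
  fixes a b x :: real
  assumes "a \<le> b"
  shows "closest_point {a..b} x = max a (min b x)"
  using closest_point_Int_Icc[of UNIV a b x] assms by (simp add: closest_point_self)

lemma closed_box:
  assumes "closed I" "closed K"
  shows "closed {z. coord_sum z \<in> I \<and> coord_diff z \<in> K}"
proof -
  have "continuous_on UNIV coord_sum" "continuous_on UNIV coord_diff"
    by (simp_all add: linear_coord_sum linear_coord_diff linear_continuous_on linear_linear)
  then have "closed (coord_sum -` I \<inter> coord_diff -` K)"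
    using assms by (intro closed_Int closed_vimage)
  moreover have "coord_sum -` I \<inter> coord_diff -` K = {z. coord_sum z \<in> I \<and> coord_diff z \<in> K}" by blast
  ultimately show ?thesis by simp
qed

text \<open>The squared Euclidean distance is half the sum of the squared distances in the two
  coordinates, so each coordinate can be minimised separately.\<close>

lemma closest_point_box:
  assumes "closed I" "convex I" "I \<noteq> {}" "closed K" "convex K" "K \<noteq> {}"
  shows "coord_sum (closest_point {z. coord_sum z \<in> I \<and> coord_diff z \<in> K} x) = closest_point I (coord_sum x)"
    and "coord_diff (closest_point {z. coord_sum z \<in> I \<and> coord_diff z \<in> K} x) = closest_point K (coord_diff x)"
proof -
  let ?S = "{z. coord_sum z \<in> I \<and> coord_diff z \<in> K}"
  let ?a = "closest_point I (coord_sum x)" and ?b = "closest_point K (coord_diff x)"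
  define y :: "real ^ 2" where "y = vector [(?a + ?b) / 2, (?a - ?b) / 2]"
  have y: "coord_sum y = ?a" "coord_diff y = ?b"
    using eq_vector2_iff y_def by blast+
  have S: "?S = coord_sum -` I \<inter> coord_diff -` K" by auto
  have "closed ?S" using assms by (intro closed_box)
  moreover have "convex ?S" unfolding S
    using assms linear_coord_sum linear_coord_diff by (intro convex_Int convex_linear_vimage)
  moreover have "y \<in> ?S" using assms y by (simp add: closest_point_in_set)
  moreover have "dist x y \<le> dist x z" if "z \<in> ?S" for z
  proof -
    have "\<bar>coord_sum x - coord_sum y\<bar> \<le> \<bar>coord_sum x - coord_sum z\<bar>" "\<bar>coord_diff x - coord_diff y\<bar> \<le> \<bar>coord_diff x - coord_diff z\<bar>"
      using that closest_point_le assms(1,4) y by (fastforce simp: dist_real_def)+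
    then show ?thesis
      by (simp add: dist_norm norm_eq_coord_sum_coord_diff coord_sum_diff coord_diff_diff abs_le_square_iff add_mono)
  qed
  ultimately have "y = closest_point ?S x" by (intro closest_point_unique) auto
  with y show "coord_sum (closest_point ?S x) = ?a" "coord_diff (closest_point ?S x) = ?b" by simp_all
qed

section \<open>Finite intersections of intervals on the line\<close>

lemma Inter_cball_eq_Icc:
  fixes c \<delta> :: "'i \<Rightarrow> real"
  assumes "finite J" "J \<noteq> {}"
  shows "(\<Inter>j\<in>J. cball (c j) (\<delta> j)) =
    {Max ((\<lambda>j. c j - \<delta> j) ` J)..Min ((\<lambda>j. c j + \<delta> j) ` J)}"
proof (rule set_eqI)
  fix x
  have "x \<in> (\<Inter>j\<in>J. cball (c j) (\<delta> j)) \<longleftrightarrow> (\<forall>j\<in>J. c j - \<delta> j \<le> x) \<and> (\<forall>j\<in>J. x \<le> c j + \<delta> j)"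
    by (auto simp: cball_eq_atLeastAtMost)
  also have "(\<forall>j\<in>J. c j - \<delta> j \<le> x) \<longleftrightarrow> Max ((\<lambda>j. c j - \<delta> j) ` J) \<le> x"
    using assms by (subst Max_le_iff) simp_all
  also have "(\<forall>j\<in>J. x \<le> c j + \<delta> j) \<longleftrightarrow> x \<le> Min ((\<lambda>j. c j + \<delta> j) ` J)"
    using assms by (subst Min_ge_iff) simp_all
  finally show "x \<in> (\<Inter>j\<in>J. cball (c j) (\<delta> j)) \<longleftrightarrow>
      x \<in> {Max ((\<lambda>j. c j - \<delta> j) ` J)..Min ((\<lambda>j. c j + \<delta> j) ` J)}"
    by (simp only: atLeastAtMost_iff)
qed

text \<open>Helly's theorem on the line: pairwise intersection puts every left end below every right
  end, hence the largest left end below the smallest right end.\<close>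

lemma Inter_cball_nonempty:
  fixes c \<delta> :: "'i \<Rightarrow> real"
  assumes "finite J" "\<And>i j. i \<in> J \<Longrightarrow> j \<in> J \<Longrightarrow> \<bar>c i - c j\<bar> \<le> \<delta> i + \<delta> j"
  shows "(\<Inter>j\<in>J. cball (c j) (\<delta> j)) \<noteq> {}"
proof (cases "J = {}")
  case False
  have "c i - \<delta> i \<le> c j + \<delta> j" if "i \<in> J" "j \<in> J" for i j
    using assms(2)[OF that] by linarith
  then show ?thesis using assms(1) False by (simp add: Inter_cball_eq_Icc)
qed simp

text \<open>The projection is \<open>x\<close> itself or an extreme end of the intervals; an index
  at which that end is attained is the witness.\<close>

lemma closest_point_Inter_cball_dist:
  fixes c \<delta> :: "'i \<Rightarrow> real"
  assumes "finite J" "J \<noteq> {}" "(\<Inter>j\<in>J. cball (c j) (\<delta> j)) \<noteq> {}"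
  shows "\<exists>j\<in>J. \<bar>x - closest_point (\<Inter>j\<in>J. cball (c j) (\<delta> j)) x\<bar> \<le> max (\<bar>x - c j\<bar> - \<delta> j) 0"
proof -
  let ?lo = "Max ((\<lambda>j. c j - \<delta> j) ` J)" and ?hi = "Min ((\<lambda>j. c j + \<delta> j) ` J)"
  have eq: "closest_point (\<Inter>j\<in>J. cball (c j) (\<delta> j)) x = max ?lo (min ?hi x)"
    using assms by (simp add: Inter_cball_eq_Icc closest_point_Icc)
  have lohi: "?lo \<le> ?hi" using assms by (simp add: Inter_cball_eq_Icc)
  obtain k where k: "k \<in> J" "?lo = c k - \<delta> k"
    using Max_in[of "(\<lambda>j. c j - \<delta> j) ` J"] assms(1,2) by (metis (no_types, lifting) finite_imageI image_iff image_is_empty)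
  obtain l where l: "l \<in> J" "?hi = c l + \<delta> l"
    using Min_in[of "(\<lambda>j. c j + \<delta> j) ` J"] assms(1,2) by (metis (no_types, lifting) finite_imageI image_iff image_is_empty)
  consider "x < ?lo" | "?hi < x" | "?lo \<le> x" "x \<le> ?hi" by linarith
  then show ?thesis
  proof cases
    case 1
    then show ?thesis unfolding eq using k lohi by (intro bexI[of _ k]) auto
  next
    case 2
    then show ?thesis unfolding eq using l lohi by (intro bexI[of _ l]) auto
  next
    case 3
    \<comment> \<open>Here \<open>x\<close> does not move, so every index in \<open>J\<close> would
      serve.\<close>
    then show ?thesis unfolding eq using k by (intro bexI[of _ k]) auto
  qed
qed

lemma closed_Inter_cball: "closed (\<Inter>j\<in>J. cball (c j) (\<delta> j))"
  and convex_Inter_cball: "convex (\<Inter>j\<in>J. cball (c j :: real) (\<delta> j))"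
  by (intro closed_INT convex_INT ballI closed_cball convex_cball)+

text \<open>One round of successive clamping. Nonemptiness is assumed for the full index set
  \<open>K\<close> and passes to every partial intersection met on the way.\<close>

lemma closest_point_insert_cball:
  fixes c \<delta> :: "'i \<Rightarrow> real"
  assumes "(\<Inter>j\<in>K. cball (c j) (\<delta> j)) \<noteq> {}" "insert j J \<subseteq> K"
  shows "closest_point (\<Inter>j\<in>insert j J. cball (c j) (\<delta> j)) x =
    max (c j - \<delta> j) (min (c j + \<delta> j) (closest_point (\<Inter>j\<in>J. cball (c j) (\<delta> j)) x))"
proof -
  have eq: "(\<Inter>j\<in>insert j J. cball (c j) (\<delta> j)) = (\<Inter>j\<in>J. cball (c j) (\<delta> j)) \<inter> {c j - \<delta> j..c j + \<delta> j}"
    by (auto simp: cball_eq_atLeastAtMost)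
  then have "(\<Inter>j\<in>J. cball (c j) (\<delta> j)) \<inter> {c j - \<delta> j..c j + \<delta> j} \<noteq> {}"
    using assms by blast
  then show ?thesis unfolding eq
    by (intro closest_point_Int_Icc closed_Inter_cball convex_Inter_cball)
qed

section \<open>The balls as boxes\<close>

lemma l1ball_eq: "l1ball y r = {z. coord_sum z \<in> cball (coord_sum y) r \<and> coord_diff z \<in> cball (coord_diff y) r}"
  by (auto simp: l1ball_def l1norm_eq_max coord_sum_diff coord_diff_diff dist_real_def)

lemma Inter_l1ball_eq:
  "(\<Inter>j\<in>J. l1ball (c j) (\<delta> j)) =
    {z. coord_sum z \<in> (\<Inter>j\<in>J. cball (coord_sum (c j)) (\<delta> j)) \<and> coord_diff z \<in> (\<Inter>j\<in>J. cball (coord_diff (c j)) (\<delta> j))}"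
  by (auto simp: l1ball_eq)

text \<open>Helly's theorem on the line, applied to each coordinate. The first two conclusions are
  recorded because the projection is computed coordinatewise.\<close>

lemma Inter_l1ball_nonempty:
  fixes c :: "'i \<Rightarrow> real ^ 2"
  assumes "finite J" "\<And>i j. i \<in> J \<Longrightarrow> j \<in> J \<Longrightarrow> l1norm (c i - c j) \<le> \<delta> i + \<delta> j"
  shows "(\<Inter>j\<in>J. cball (coord_sum (c j)) (\<delta> j)) \<noteq> {}"
    and "(\<Inter>j\<in>J. cball (coord_diff (c j)) (\<delta> j)) \<noteq> {}"
    and "(\<Inter>j\<in>J. l1ball (c j) (\<delta> j)) \<noteq> {}"
proof -
  show u: "(\<Inter>j\<in>J. cball (coord_sum (c j)) (\<delta> j)) \<noteq> {}"
    using assms by (intro Inter_cball_nonempty) (auto simp: l1norm_eq_max coord_sum_diff coord_diff_diff)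
  show v: "(\<Inter>j\<in>J. cball (coord_diff (c j)) (\<delta> j)) \<noteq> {}"
    using assms by (intro Inter_cball_nonempty) (auto simp: l1norm_eq_max coord_sum_diff coord_diff_diff)
  obtain a b where "a \<in> (\<Inter>j\<in>J. cball (coord_sum (c j)) (\<delta> j))" "b \<in> (\<Inter>j\<in>J. cball (coord_diff (c j)) (\<delta> j))"
    using u v by blast
  moreover obtain z :: "real ^ 2" where "coord_sum z = a" "coord_diff z = b" using eq_vector2_iff by blast
  ultimately have "z \<in> (\<Inter>j\<in>J. l1ball (c j) (\<delta> j))" by (simp add: Inter_l1ball_eq)
  then show "(\<Inter>j\<in>J. l1ball (c j) (\<delta> j)) \<noteq> {}" by blast
qed

lemma closed_Inter_l1ball:
  fixes c :: "'i \<Rightarrow> real ^ 2"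
  shows "closed (\<Inter>j\<in>J. l1ball (c j) (\<delta> j))"
  unfolding Inter_l1ball_eq by (intro closed_box closed_Inter_cball)

section \<open>Sensitivity and error\<close>

lemma sens_preproc_empty [simp]: "sens_preproc f \<Delta> fmempty = f fmempty"
  by (simp add: sens_preproc.simps)

lemma sens_preproc_nonempty:
  "D \<noteq> fmempty \<Longrightarrow> sens_preproc f \<Delta> D =
    closest_point (\<Inter>i\<in>fmdom' D. l1ball (sens_preproc f \<Delta> (fmdrop i D)) (\<Delta> i)) (f D)"
  by (simp add: sens_preproc.simps)

lemma fmdom'_eq_empty_iff [simp]: "fmdom' D = {} \<longleftrightarrow> D = fmempty"
  by (metis fmdom'_empty fmrestrict_set_dom fmrestrict_set_null)

lemma card_fmdom'_fmdrop: "i \<in> fmdom' D \<Longrightarrow> card (fmdom' (fmdrop i D)) < card (fmdom' D)"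
  using card_Diff1_less[of "fmdom' D" i] by simp

lemma fmdrop_commute: "fmdrop i (fmdrop j D) = fmdrop j (fmdrop i D)"
  by (rule fmap_ext) auto

text \<open>Nonemptiness of the intersection at \<open>D\<close> rests on the bound for the
  databases with one record less, and the bound at \<open>D\<close> rests on nonemptiness; one
  induction on the size yields both.\<close>

lemma sens_preproc_dist:
  assumes "\<And>i. 0 \<le> \<Delta> i" "i \<in> fmdom' D"
  shows "l1norm (sens_preproc f \<Delta> D - sens_preproc f \<Delta> (fmdrop i D)) \<le> \<Delta> i"
  using assms(2)
proof (induction "card (fmdom' D)" arbitrary: D i rule: less_induct)
  case less
  let ?g = "sens_preproc f \<Delta>"
  have "l1norm (?g (fmdrop i D) - ?g (fmdrop j D)) \<le> \<Delta> i + \<Delta> j"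
    if ij: "i \<in> fmdom' D" "j \<in> fmdom' D" for i j
  proof (cases "i = j")
    case True
    \<comment> \<open>The distance is zero, so the claim reduces to nonnegativity of the
      parameter.\<close>
    then show ?thesis using assms(1)[of j] by (simp add: l1norm_def)
  next
    case False
    \<comment> \<open>The two centres are compared through the database lacking both individuals,
      which is reached by either order of removal.\<close>
    have "l1norm (?g (fmdrop i D) - ?g (fmdrop j (fmdrop i D))) \<le> \<Delta> j"
      using False ij less.hyps card_fmdom'_fmdrop by fastforce
    moreover have "l1norm (?g (fmdrop j D) - ?g (fmdrop i (fmdrop j D))) \<le> \<Delta> i"
      using False ij less.hyps card_fmdom'_fmdrop by fastforce
    ultimately show ?thesis
      using l1norm_triangle[of "?g (fmdrop i D)" "?g (fmdrop j D)" "?g (fmdrop j (fmdrop i D))"]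
      by (simp add: l1norm_commute[of "?g (fmdrop j D)"] fmdrop_commute[of i j])
  qed
  then have "(\<Inter>i\<in>fmdom' D. l1ball (?g (fmdrop i D)) (\<Delta> i)) \<noteq> {}"
    by (intro Inter_l1ball_nonempty(3)) auto
  moreover have "D \<noteq> fmempty" using less.prems by auto
  ultimately have "?g D \<in> (\<Inter>i\<in>fmdom' D. l1ball (?g (fmdrop i D)) (\<Delta> i))"
    unfolding sens_preproc_nonempty[OF \<open>D \<noteq> fmempty\<close>] by (intro closest_point_in_set closed_Inter_l1ball)
  then have "?g D \<in> l1ball (?g (fmdrop i D)) (\<Delta> i)" using less.prems by blast
  then show ?case by (simp add: l1ball_def)
qed

text \<open>With the bound available at \<open>D\<close> itself, both values are compared with the
  value at \<open>D\<close>. This is the pairwise condition for the balls that define that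
  value.\<close>

lemma sens_preproc_dist_fmdrop2:
  assumes "\<And>i. 0 \<le> \<Delta> i" "i \<in> fmdom' D" "j \<in> fmdom' D"
  shows "l1norm (sens_preproc f \<Delta> (fmdrop i D) - sens_preproc f \<Delta> (fmdrop j D)) \<le> \<Delta> i + \<Delta> j"
  using l1norm_triangle[of "sens_preproc f \<Delta> (fmdrop i D)" "sens_preproc f \<Delta> (fmdrop j D)" "sens_preproc f \<Delta> D"]
    sens_preproc_dist[of \<Delta> i D f] sens_preproc_dist[of \<Delta> j D f] assms
  by (simp add: l1norm_commute)

text \<open>The planar recursion splits into two independent recursions on the line, with the
  nonemptiness that clamping requires.\<close>

lemma sens_preproc_coords:
  fixes f :: "('i, 'r) database \<Rightarrow> real ^ 2" and \<Delta> :: "'i \<Rightarrow> real"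
  assumes "\<And>i. 0 \<le> \<Delta> i" "D \<noteq> fmempty"
  defines "g \<equiv> sens_preproc f \<Delta>"
  shows "coord_sum (g D) = closest_point (\<Inter>i\<in>fmdom' D. cball (coord_sum (g (fmdrop i D))) (\<Delta> i)) (coord_sum (f D))"
    and "coord_diff (g D) = closest_point (\<Inter>i\<in>fmdom' D. cball (coord_diff (g (fmdrop i D))) (\<Delta> i)) (coord_diff (f D))"
    and "(\<Inter>i\<in>fmdom' D. cball (coord_sum (g (fmdrop i D))) (\<Delta> i)) \<noteq> {}"
    and "(\<Inter>i\<in>fmdom' D. cball (coord_diff (g (fmdrop i D))) (\<Delta> i)) \<noteq> {}"
proof -
  have "l1norm (g (fmdrop i D) - g (fmdrop j D)) \<le> \<Delta> i + \<Delta> j"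
    if "i \<in> fmdom' D" "j \<in> fmdom' D" for i j
    unfolding g_def using assms(1) that by (rule sens_preproc_dist_fmdrop2)
  then show u: "(\<Inter>i\<in>fmdom' D. cball (coord_sum (g (fmdrop i D))) (\<Delta> i)) \<noteq> {}"
    and v: "(\<Inter>i\<in>fmdom' D. cball (coord_diff (g (fmdrop i D))) (\<Delta> i)) \<noteq> {}"
    by (intro Inter_l1ball_nonempty finite_fmdom'; simp)+
  have "g D = closest_point (\<Inter>i\<in>fmdom' D. l1ball (g (fmdrop i D)) (\<Delta> i)) (f D)"
    unfolding g_def by (rule sens_preproc_nonempty[OF assms(2)])
  then show "coord_sum (g D) = closest_point (\<Inter>i\<in>fmdom' D. cball (coord_sum (g (fmdrop i D))) (\<Delta> i)) (coord_sum (f D))"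
    and "coord_diff (g D) = closest_point (\<Inter>i\<in>fmdom' D. cball (coord_diff (g (fmdrop i D))) (\<Delta> i)) (coord_diff (f D))"
    unfolding Inter_l1ball_eq
    by (simp_all only: closest_point_box[OF closed_Inter_cball convex_Inter_cball u closed_Inter_cball convex_Inter_cball v])
qed

text \<open>The norm is the larger of the two coordinate errors, so the individual that bounds that
  coordinate serves; replacing a coordinate distance by the norm on the right only weakens the
  bound.\<close>

lemma sens_preproc_error_step:
  assumes "\<And>i. 0 \<le> \<Delta> i" "D \<noteq> fmempty"
  shows "\<exists>i\<in>fmdom' D. l1norm (f D - sens_preproc f \<Delta> D) \<le>
    max (l1norm (f D - sens_preproc f \<Delta> (fmdrop i D)) - \<Delta> i) 0"
proof -
  let ?g = "sens_preproc f \<Delta>"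
  note c = sens_preproc_coords[of \<Delta>, OF assms, of f]
  have ne: "fmdom' D \<noteq> {}" using assms(2) by simp
  obtain i where i: "i \<in> fmdom' D"
    "\<bar>coord_sum (f D) - coord_sum (?g D)\<bar> \<le> max (\<bar>coord_sum (f D) - coord_sum (?g (fmdrop i D))\<bar> - \<Delta> i) 0"
    using closest_point_Inter_cball_dist[OF finite_fmdom' ne c(3), of "coord_sum (f D)"]
    unfolding c(1)[symmetric] by blast
  obtain j where j: "j \<in> fmdom' D"
    "\<bar>coord_diff (f D) - coord_diff (?g D)\<bar> \<le> max (\<bar>coord_diff (f D) - coord_diff (?g (fmdrop j D))\<bar> - \<Delta> j) 0"
    using closest_point_Inter_cball_dist[OF finite_fmdom' ne c(4), of "coord_diff (f D)"]
    unfolding c(2)[symmetric] by blast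
  show ?thesis
  proof (cases "\<bar>coord_diff (f D) - coord_diff (?g D)\<bar> \<le> \<bar>coord_sum (f D) - coord_sum (?g D)\<bar>")
    case True
    then have "l1norm (f D - ?g D) = \<bar>coord_sum (f D) - coord_sum (?g D)\<bar>"
      by (simp add: l1norm_eq_max coord_sum_diff coord_diff_diff)
    moreover have "\<bar>coord_sum (f D) - coord_sum (?g (fmdrop i D))\<bar> \<le> l1norm (f D - ?g (fmdrop i D))"
      by (simp add: l1norm_eq_max coord_sum_diff coord_diff_diff)
    ultimately have "l1norm (f D - ?g D) \<le> max (l1norm (f D - ?g (fmdrop i D)) - \<Delta> i) 0"
      using i(2) by linarith
    with i(1) show ?thesis by blast
  next
    case False
    then have "l1norm (f D - ?g D) = \<bar>coord_diff (f D) - coord_diff (?g D)\<bar>"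
      by (simp add: l1norm_eq_max coord_sum_diff coord_diff_diff)
    moreover have "\<bar>coord_diff (f D) - coord_diff (?g (fmdrop j D))\<bar> \<le> l1norm (f D - ?g (fmdrop j D))"
      by (simp add: l1norm_eq_max coord_sum_diff coord_diff_diff)
    ultimately have "l1norm (f D - ?g D) \<le> max (l1norm (f D - ?g (fmdrop j D)) - \<Delta> j) 0"
      using j(2) by linarith
    with j(1) show ?thesis by blast
  qed
qed

section \<open>Orders of the records and the error bound\<close>

lemma prefix_db_id: "k \<le> length ys \<Longrightarrow> prefix_db ys id k = fmap_of_list (take k ys)"
  unfolding prefix_db_def by (rule arg_cong[of _ _ fmap_of_list], rule nth_equalityI) auto

text \<open>Appending a record leaves all earlier prefixes unchanged, so exactly one summand is
  added.\<close>

lemma path_error_snoc: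
  "path_error f \<Delta> (ys @ [(i, x)]) id = path_error f \<Delta> ys id +
    max (l1norm (f (fmupd i x (fmap_of_list ys)) - f (fmap_of_list ys)) - \<Delta> i) 0"
  by (simp add: path_error_def Let_def prefix_db_id nth_append split_beta)

lemma path_error_nonneg: "0 \<le> path_error f \<Delta> ys \<sigma>"
  unfolding path_error_def by (intro sum_nonneg) (simp add: Let_def split_beta)

text \<open>Trades a permutation for a rearranged list, so that the induction can build lists and
  keep \<open>id\<close>.\<close>

lemma path_error_permute_list:
  assumes "\<sigma> permutes {..<length xs}"
  shows "path_error f \<Delta> (permute_list \<sigma> xs) id = path_error f \<Delta> xs \<sigma>"
  unfolding path_error_def
proof (intro sum.cong)
  fix k assume "k \<in> {..<length xs}"
  then have "prefix_db (permute_list \<sigma> xs) id k = prefix_db xs \<sigma> k"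
    using permute_list_nth[OF assms] by (auto simp: prefix_db_def intro!: arg_cong[of _ _ fmap_of_list])
  then show "(let (i, x) = permute_list \<sigma> xs ! id k; D = prefix_db (permute_list \<sigma> xs) id k
      in max (l1norm (f (fmupd i x D) - f D) - \<Delta> i) 0) =
    (let (i, x) = xs ! \<sigma> k; D = prefix_db xs \<sigma> k
      in max (l1norm (f (fmupd i x D) - f D) - \<Delta> i) 0)"
    using \<open>k \<in> _\<close> permute_list_nth[OF assms] by simp
qed simp

text \<open>The first entry for a key wins in a list, so an appended entry takes effect only for a
  fresh key.\<close>

lemma fmap_of_list_snoc:
  assumes "i \<notin> fst ` set ys"
  shows "fmap_of_list (ys @ [(i, x)]) = fmupd i x (fmap_of_list ys)"
proof (rule fmap_ext)
  fix j
  have "map_of ys i = None" using assms by (simp add: map_of_eq_None_iff)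
  then show "fmlookup (fmap_of_list (ys @ [(i, x)])) j = fmlookup (fmupd i x (fmap_of_list ys)) j"
    by (cases "map_of ys j") (auto simp: fmlookup_of_list map_add_def simp del: fmap_of_list_app)
qed

lemma fmupd_fmdrop: "fmlookup D i = Some x \<Longrightarrow> fmupd i x (fmdrop i D) = D"
  by (rule fmap_ext) auto

lemma fmdrop_fmupd_fresh: "i \<notin> fmdom' D \<Longrightarrow> fmdrop i (fmupd i x D) = D"
  by (rule fmap_ext) (auto simp: fmdom'_notD)

text \<open>The order is built from its end: the individual of the error step goes last, and the
  induction hypothesis orders the others.\<close>

lemma sens_preproc_error:
  assumes "\<And>i. 0 \<le> \<Delta> i"
  shows "\<exists>ys. distinct (map fst ys) \<and> fmap_of_list ys = D \<and>
    l1norm (f D - sens_preproc f \<Delta> D) \<le> path_error f \<Delta> ys id"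
proof (induction "card (fmdom' D)" arbitrary: D rule: less_induct)
  case less
  show ?case
  proof (cases "D = fmempty")
    case True
    then show ?thesis by (intro exI[of _ "[]"]) (simp add: l1norm_def path_error_def)
  next
    case False
    then obtain i where i: "i \<in> fmdom' D"
      "l1norm (f D - sens_preproc f \<Delta> D) \<le> max (l1norm (f D - sens_preproc f \<Delta> (fmdrop i D)) - \<Delta> i) 0"
      using sens_preproc_error_step assms by blast
    let ?E = "fmdrop i D"
    obtain x where x: "fmlookup D i = Some x" using i(1) by (auto simp: fmlookup_dom'_iff)
    obtain ys where ys: "distinct (map fst ys)" "fmap_of_list ys = ?E"
      "l1norm (f ?E - sens_preproc f \<Delta> ?E) \<le> path_error f \<Delta> ys id"
      using less card_fmdom'_fmdrop[OF i(1)] by blast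
    have fresh: "i \<notin> fst ` set ys"
    proof
      assume "i \<in> fst ` set ys"
      then have "fmlookup (fmap_of_list ys) i \<noteq> None"
        by (simp add: fmlookup_of_list map_of_eq_None_iff)
      with ys(2) show False by simp
    qed
    \<comment> \<open>The triangle inequality passes through \<open>f ?E\<close>. If the maximum in
      the error step is \<open>0\<close>, nonnegativity of the path error suffices.\<close>
    have "l1norm (f D - sens_preproc f \<Delta> D) \<le> path_error f \<Delta> (ys @ [(i, x)]) id"
      unfolding path_error_snoc ys(2) fmupd_fmdrop[OF x]
      using i(2) ys(3) path_error_nonneg[of f \<Delta> ys id] l1norm_triangle[of "f D" "sens_preproc f \<Delta> ?E" "f ?E"]
      by linarith
    moreover have "fmap_of_list (ys @ [(i, x)]) = D"
      using fmap_of_list_snoc[OF fresh] ys(2) fmupd_fmdrop[OF x] by simp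
    ultimately show ?thesis using ys(1) fresh by (intro exI[of _ "ys @ [(i, x)]"]) auto
  qed
qed

text \<open>A database determines its listing up to order; this turns the order found by the
  induction into a permutation of \<open>xs\<close>.\<close>

lemma set_eq_if_fmap_of_list_eq:
  assumes "distinct (map fst xs)" "distinct (map fst ys)" "fmap_of_list xs = fmap_of_list ys"
  shows "set xs = set ys"
proof -
  have "map_of xs = map_of ys" using assms(3) by (metis fmlookup_of_list)
  then show ?thesis using assms(1,2) by (simp add: map_of_inject_set)
qed

lemma sens_preproc_error_Max:
  assumes "\<And>i. 0 \<le> \<Delta> i" "distinct (map fst xs)"
  shows "l1norm (f (fmap_of_list xs) - sens_preproc f \<Delta> (fmap_of_list xs))
    \<le> Max (path_error f \<Delta> xs ` {\<sigma>. \<sigma> permutes {..<length xs}})"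
proof -
  obtain ys where ys: "distinct (map fst ys)" "fmap_of_list ys = fmap_of_list xs"
    "l1norm (f (fmap_of_list xs) - sens_preproc f \<Delta> (fmap_of_list xs)) \<le> path_error f \<Delta> ys id"
    using sens_preproc_error assms(1) by blast
  have "mset ys = mset xs"
    using set_eq_if_fmap_of_list_eq[OF assms(2) ys(1) ys(2)[symmetric]] assms(2) ys(1)
    by (simp add: set_eq_iff_mset_eq_distinct distinct_map)
  then obtain \<sigma> where "\<sigma> permutes {..<length xs}" "permute_list \<sigma> xs = ys"
    by (rule mset_eq_permutation)
  with ys(3) have "l1norm (f (fmap_of_list xs) - sens_preproc f \<Delta> (fmap_of_list xs)) \<le> path_error f \<Delta> xs \<sigma>"
    using path_error_permute_list by metis
  also have "\<dots> \<le> Max (path_error f \<Delta> xs ` {\<sigma>. \<sigma> permutes {..<length xs}})"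
    using \<open>\<sigma> permutes _\<close> by (intro Max_ge finite_imageI finite_permutations) auto
  finally show ?thesis .
qed

lemma sensitivity_sens_preproc:
  fixes U :: "('i, 'r) database set"
  assumes "\<And>i. 0 \<le> \<Delta> i"
  shows "sensitivity U (sens_preproc f \<Delta>) i \<le> ennreal (\<Delta> i)"
  unfolding sensitivity_def
proof (intro SUP_least, clarify)
  fix D :: "('i, 'r) database" and x assume "i \<notin> fmdom' D"
  then show "ennreal (l1norm (sens_preproc f \<Delta> D - sens_preproc f \<Delta> (fmupd i x D))) \<le> ennreal (\<Delta> i)"
    using sens_preproc_dist[of \<Delta> i "fmupd i x D" f] assms
    by (simp add: fmdrop_fmupd_fresh l1norm_commute ennreal_leI)
qed

section \<open>Total correctness and running time of programs\<close>

text \<open>A weakest precondition for total correctness whose postcondition also sees the running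
  time.\<close>

definition runs ::
    "(nat \<Rightarrow> nat) \<Rightarrow> (('i, 'r) database \<Rightarrow> real ^ 2) \<Rightarrow> ('i \<times> 'r) list \<Rightarrow> com \<Rightarrow>
     ('i, 'r) state \<Rightarrow> (nat \<Rightarrow> ('i, 'r) state \<Rightarrow> bool) \<Rightarrow> bool" where
  "runs T f xs c s Q \<longleftrightarrow> (\<exists>t s'. exec T f xs c s t s' \<and> Q t s')"

lemma runs_mono:
  "runs T f xs c s Q \<Longrightarrow> (\<And>t s'. Q t s' \<Longrightarrow> R t s') \<Longrightarrow> runs T f xs c s R"
  unfolding runs_def by blast

text \<open>Determinism upgrades the implication to an equivalence, so that straight-line code can
  be evaluated by rewriting.\<close>

lemma runs_iff_exec: "exec T f xs c s t s' \<Longrightarrow> runs T f xs c s Q \<longleftrightarrow> Q t s'"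
  unfolding runs_def using exec_deterministic by metis

lemmas runs_Skip = runs_iff_exec[OF exec.Skip]
  and runs_NWrite = runs_iff_exec[OF exec.NWrite]
  and runs_RWrite = runs_iff_exec[OF exec.RWrite]
  and runs_ClearBuffer = runs_iff_exec[OF exec.ClearBuffer]
  and runs_InsertRecord = runs_iff_exec[OF exec.InsertRecord]
  and runs_Query = runs_iff_exec[OF exec.Query]

lemma runs_Seq:
  "runs T f xs (Seq c d) s Q \<longleftrightarrow> runs T f xs c s (\<lambda>t s'. runs T f xs d s' (\<lambda>u. Q (t + u)))"
proof
  assume "runs T f xs (Seq c d) s Q"
  then obtain t s' where "exec T f xs (Seq c d) s t s'" "Q t s'" by (auto simp: runs_def)
  then show "runs T f xs c s (\<lambda>t s'. runs T f xs d s' (\<lambda>u. Q (t + u)))"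
    by cases (auto simp: runs_def)
qed (auto simp: runs_def intro: exec.Seq)

lemma runs_Cond:
  "runs T f xs (Cond b c d) s Q \<longleftrightarrow>
    runs T f xs (if bval s b then c else d) s (\<lambda>t. Q (1 + bcost b + t))"
proof
  assume "runs T f xs (Cond b c d) s Q"
  then obtain t s' where "exec T f xs (Cond b c d) s t s'" "Q t s'" by (auto simp: runs_def)
  then show "runs T f xs (if bval s b then c else d) s (\<lambda>t. Q (1 + bcost b + t))"
    by cases (auto simp: runs_def)
next
  assume "runs T f xs (if bval s b then c else d) s (\<lambda>t. Q (1 + bcost b + t))"
  then show "runs T f xs (Cond b c d) s Q"
    unfolding runs_def by (metis exec.CondTrue exec.CondFalse)
qed

lemmas runs_simps = runs_Skip runs_NWrite runs_RWrite runs_ClearBuffer runs_Query runs_Seq runs_Cond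

text \<open>The invariant carries the number of completed rounds, so termination needs no separate
  measure. The final summand of the bound pays for the failing test.\<close>

lemma runs_While:
  assumes "I 0 s"
    and step: "\<And>k s. k < N \<Longrightarrow> I k s \<Longrightarrow>
      bval s b \<and> runs T f xs c s (\<lambda>t s'. t \<le> C \<and> I (Suc k) s')"
    and exit: "\<And>s. I N s \<Longrightarrow> \<not> bval s b"
  shows "runs T f xs (While b c) s (\<lambda>t s'. t \<le> N * (1 + bcost b + C) + (1 + bcost b) \<and> I N s')"
proof -
  have "runs T f xs (While b c) s (\<lambda>t s'. t \<le> (N - k) * (1 + bcost b + C) + (1 + bcost b) \<and> I N s')"
    if "k \<le> N" "I k s" for k s
    using that
  proof (induction arbitrary: s rule: inc_induct)
    case base
    then show ?case unfolding runs_def using exec.WhileFalse[OF exit] by fastforce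
  next
    case (step k)
    obtain t s' where t: "exec T f xs c s t s'" "t \<le> C" "I (Suc k) s'" and b: "bval s b"
      using assms(2)[OF step.hyps(2) step.prems] by (auto simp: runs_def)
    obtain u s'' where u: "exec T f xs (While b c) s' u s''"
        "u \<le> (N - Suc k) * (1 + bcost b + C) + (1 + bcost b)" "I N s''"
      using step.IH[OF t(3)] by (auto simp: runs_def)
    have "(N - k) * (1 + bcost b + C) = (1 + bcost b + C) + (N - Suc k) * (1 + bcost b + C)"
      using step.hyps(2) by (metis Suc_diff_Suc mult_Suc)
    then have "1 + bcost b + t + u \<le> (N - k) * (1 + bcost b + C) + (1 + bcost b)"
      using t(2) u(2) by linarith
    then show ?case unfolding runs_def using exec.WhileTrue[OF b t(1) u(1)] u(3) by blast
  qed
  from this[of 0] assms(1) show ?thesis by simp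
qed

section \<open>The program\<close>

abbreviation NVar :: "vname \<Rightarrow> nexp" where
  "NVar v \<equiv> NRead v (NConst 0)"

text \<open>Powers of two are tabulated by doubling, because natural numbers cannot be
  multiplied.\<close>

definition powers_prog :: com where
  "powers_prog = Seq (NWrite ''p'' (NConst 0) (NConst 1))
    (While (NLess (NVar ''i'') (NVar ''n''))
      (Seq (NWrite ''p'' (NAdd (NVar ''i'') (NConst 1))
             (NAdd (NRead ''p'' (NVar ''i'')) (NRead ''p'' (NVar ''i''))))
           (NWrite ''i'' (NConst 0) (NAdd (NVar ''i'') (NConst 1)))))"

text \<open>Runs \<open>c\<close> with \<open>i\<close> ranging over the binary digits of \<open>m\<close> that are \<open>1\<close>, in decreasing order.
  As there is no division, a digit is found by comparing the remainder \<open>r\<close> with \<open>p[i] = 2\<^sup>i\<close>.\<close>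

definition for_bits_prog :: "com \<Rightarrow> com" where
  "for_bits_prog c = Seq (NWrite ''i'' (NConst 0) (NVar ''n''))
    (Seq (NWrite ''r'' (NConst 0) (NVar ''m''))
      (While (NLess (NConst 0) (NVar ''i''))
        (Seq (NWrite ''i'' (NConst 0) (NSub (NVar ''i'') (NConst 1)))
          (Cond (NLess (NVar ''r'') (NRead ''p'' (NVar ''i''))) Skip
            (Seq (NWrite ''r'' (NConst 0) (NSub (NVar ''r'') (NRead ''p'' (NVar ''i'')))) c)))))"

text \<open>The index \<open>m - p[i]\<close> codes the subset without position \<open>i\<close>, so
  \<open>c\<close> is a coordinate of the centre and \<open>d\<close> the radius. The expression
  \<open>y\<close> is evaluated again in the second test.\<close>

definition clamp_prog :: "vname \<Rightarrow> com" where
  "clamp_prog a =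
    (let y = RRead a (NVar ''m'');
         c = RRead a (NSub (NVar ''m'') (NRead ''p'' (NVar ''i'')));
         d = RRead ''Delta'' (NVar ''i'')
     in Seq (Cond (RLess y (RSub c d)) (RWrite a (NVar ''m'') (RSub c d)) Skip)
            (Cond (RLess (RAdd c d) y) (RWrite a (NVar ''m'') (RAdd c d)) Skip))"

text \<open>Entry \<open>m\<close> of the arrays \<open>u\<close> and \<open>v\<close> holds the two coordinates of \<open>g\<close> at the subset of the records
  whose positions are the binary digits of \<open>m\<close>.\<close>

definition subset_prog :: com where
  "subset_prog = Seq ClearBuffer
    (Seq (for_bits_prog (InsertRecord (NVar ''i'')))
    (Seq (Query ''q'')
    (Seq (RWrite ''u'' (NVar ''m'') (RAdd (RRead ''q'' (NConst 0)) (RRead ''q'' (NConst 1))))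
    (Seq (RWrite ''v'' (NVar ''m'') (RSub (RRead ''q'' (NConst 0)) (RRead ''q'' (NConst 1))))
    (Seq (for_bits_prog (Seq (clamp_prog ''u'') (clamp_prog ''v'')))
         (NWrite ''m'' (NConst 0) (NAdd (NVar ''m'') (NConst 1))))))))"

text \<open>The loop ends with \<open>m = 2 ^ n\<close>, so entry \<open>m - 1\<close> belongs to
  the whole database; the last two writes undo the change of coordinates.\<close>

definition sens_preproc_prog :: com where
  "sens_preproc_prog = Seq powers_prog
    (Seq (While (NLess (NVar ''m'') (NRead ''p'' (NVar ''n''))) subset_prog)
    (let u = RRead ''u'' (NSub (NVar ''m'') (NConst 1));
         v = RRead ''v'' (NSub (NVar ''m'') (NConst 1))
     in Seq (RWrite ''out'' (NConst 0) (RDiv (RAdd u v) (RConst 2)))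
            (RWrite ''out'' (NConst 1) (RDiv (RSub u v) (RConst 2)))))"

section \<open>Correctness and running time of the building blocks\<close>

lemma rmem_rwrite [simp]: "rmem (rwrite v k x s) = (rmem s)(v := (rmem s v)(k := x))"
  and nmem_rwrite [simp]: "nmem (rwrite v k x s) = nmem s"
  and buffer_rwrite [simp]: "buffer (rwrite v k x s) = buffer s"
  and nmem_nwrite [simp]: "nmem (nwrite v k y s) = (nmem s)(v := (nmem s v)(k := y))"
  and rmem_nwrite [simp]: "rmem (nwrite v k y s) = rmem s"
  and buffer_nwrite [simp]: "buffer (nwrite v k y s) = buffer s"
  by (simp_all add: rwrite_def nwrite_def)

lemma runs_powers_prog:
  assumes "nmem s ''n'' 0 = n" "nmem s ''i'' 0 = 0"
  shows "runs T f xs powers_prog s (\<lambda>t s'. t \<le> 40 * n + 40 \<and> (\<forall>j\<le>n. nmem s' ''p'' j = 2 ^ j) \<and>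
    (\<forall>v. v \<noteq> ''p'' \<and> v \<noteq> ''i'' \<longrightarrow> nmem s' v = nmem s v) \<and> rmem s' = rmem s)"
proof -
  let ?I = "\<lambda>k s'. nmem s' ''i'' 0 = k \<and> (\<forall>j\<le>k. nmem s' ''p'' j = 2 ^ j) \<and>
    (\<forall>v. v \<noteq> ''p'' \<and> v \<noteq> ''i'' \<longrightarrow> nmem s' v = nmem s v) \<and> rmem s' = rmem s"
  show ?thesis
    unfolding powers_prog_def runs_simps
    apply (rule runs_mono)
     \<comment> \<open>The body takes 18 steps; here and below the constants are generous.\<close>
     apply (rule runs_While[where I = ?I and N = n and C = 30])
    subgoal using assms by simp
    subgoal using assms(1) by (simp add: runs_simps le_Suc_eq)
    subgoal using assms by simp
    subgoal by auto
    done
qed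

lemma bit_nat_imp_le: "bit (k :: nat) j \<Longrightarrow> 2 ^ j \<le> k"
  by (metis bit_iff_odd div_less even_zero not_le)

text \<open>Since \<open>take_bit j k < 2 ^ j\<close>, comparing the left side with
  \<open>2 ^ j\<close> reveals digit \<open>j\<close>, and subtracting leaves the next
  remainder.\<close>

lemma take_bit_Suc_nat: "take_bit (Suc j) k = take_bit j k + (if bit k j then 2 ^ j else 0)"
  for k :: nat
  by (simp add: take_bit_Suc_from_most)

text \<open>\<open>P\<close> is indexed by the set of digits already treated. It speaks only of the
  reals and the buffer, since the body must preserve the natural-number memory that drives the
  scan.\<close>

lemma runs_for_bits_prog:
  fixes k n :: nat
  assumes n: "nmem s ''n'' 0 = n" and k: "nmem s ''m'' 0 = k" "k < 2 ^ n"
    and p: "\<And>j. j \<le> n \<Longrightarrow> nmem s ''p'' j = 2 ^ j"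
    and start: "P {} (rmem s) (buffer s)"
    and body: "\<And>j J s'. j < n \<Longrightarrow> bit k j \<Longrightarrow> J \<subseteq> {j. bit k j} \<Longrightarrow> P J (rmem s') (buffer s') \<Longrightarrow>
      (\<And>v. v \<noteq> ''i'' \<Longrightarrow> v \<noteq> ''r'' \<Longrightarrow> nmem s' v = nmem s v) \<Longrightarrow> nmem s' ''i'' 0 = j \<Longrightarrow>
      runs T f xs c s' (\<lambda>t s''. t \<le> C \<and> nmem s'' = nmem s' \<and> P (insert j J) (rmem s'') (buffer s''))"
  shows "runs T f xs (for_bits_prog c) s (\<lambda>t s'. t \<le> n * (C + 40) + 20 \<and>
    (\<forall>v. v \<noteq> ''i'' \<and> v \<noteq> ''r'' \<longrightarrow> nmem s' v = nmem s v) \<and> P {j. bit k j} (rmem s') (buffer s'))"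
proof -
  \<comment> \<open>After \<open>l\<close> rounds the one-digits from position \<open>n - l\<close>
    upwards have been treated and \<open>r\<close> holds the lower digits.\<close>
  let ?I = "\<lambda>l s'. nmem s' ''i'' 0 = n - l \<and> nmem s' ''r'' 0 = take_bit (n - l) k \<and>
    (\<forall>v. v \<noteq> ''i'' \<and> v \<noteq> ''r'' \<longrightarrow> nmem s' v = nmem s v) \<and>
    P {j. bit k j \<and> n - l \<le> j} (rmem s') (buffer s')"
  have "\<not> bit k j" if "n \<le> j" for j
    using bit_nat_imp_le[of k j] k(2) power_increasing[OF that, of "2 :: nat"] by linarith
  then have none: "{j. bit k j \<and> n \<le> j} = {}" by blast
  have step: "bval s' (NLess (NConst 0) (NVar ''i'')) \<and> runs T f xs
      (Seq (NWrite ''i'' (NConst 0) (NSub (NVar ''i'') (NConst 1)))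
          (Cond (NLess (NVar ''r'') (NRead ''p'' (NVar ''i''))) Skip
            (Seq (NWrite ''r'' (NConst 0) (NSub (NVar ''r'') (NRead ''p'' (NVar ''i'')))) c)))
      s' (\<lambda>t s''. t \<le> C + 30 \<and> ?I (Suc l) s'')"
    if l: "l < n" and I: "?I l s'" for l s'
  proof -
    define j where "j = n - Suc l"
    have j: "n - l = Suc j" "n - Suc l = j" "j < n" using l by (simp_all add: j_def)
    have pj: "nmem s ''p'' j = 2 ^ j" using p[of j] j by simp
    have lt: "take_bit j k < 2 ^ j" by simp
    show ?thesis
    proof (cases "bit k j")
      case False
      then have "{i. bit k i \<and> Suc j \<le> i} = {i. bit k i \<and> j \<le> i}"
        by (metis (lifting) Suc_leD Suc_leI le_neq_implies_less)
      with I False lt show ?thesis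
        by (simp add: j pj runs_simps take_bit_Suc_nat)
    next
      case True
      then have ins: "insert j {i. bit k i \<and> Suc j \<le> i} = {i. bit k i \<and> j \<le> i}"
        by (auto simp: Suc_le_eq)
      let ?s = "nwrite ''r'' 0 (take_bit j k) (nwrite ''i'' 0 j s')"
      have "runs T f xs c ?s (\<lambda>t s''. t \<le> C \<and> nmem s'' = nmem ?s \<and>
          P (insert j {i. bit k i \<and> Suc j \<le> i}) (rmem s'') (buffer s''))"
        using I True j by (intro body) auto
      \<comment> \<open>The \<open>21\<close> steps are the decrement of \<open>i\<close>, the test
        and the update of \<open>r\<close>.\<close>
      then have "runs T f xs c ?s (\<lambda>t s''. 21 + t \<le> C + 30 \<and> ?I (Suc l) s'')"
        unfolding ins by (rule runs_mono) (use I j in auto)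
      with I True lt show ?thesis
        by (simp add: j pj runs_simps take_bit_Suc_nat)
    qed
  qed
  show ?thesis
    unfolding for_bits_prog_def runs_simps
    apply (rule runs_mono)
     apply (rule runs_While[where I = ?I and N = n and C = "C + 30"])
    subgoal using n k start by (simp add: take_bit_nat_eq_self none)
    subgoal using step by blast
    subgoal by simp
    subgoal by (auto simp: algebra_simps)
    done
qed

text \<open>A nonnegative radius gives \<open>c - d \<le> c + d\<close>, so a write by the first
  conditional never triggers the second.\<close>

lemma runs_clamp_prog:
  assumes "nmem s ''m'' 0 = k" "nmem s ''i'' 0 = j" "0 < nmem s ''p'' j" "nmem s ''p'' j \<le> k"
    and "a \<noteq> ''Delta''" "0 \<le> rmem s ''Delta'' j"
  defines "c \<equiv> rmem s a (k - nmem s ''p'' j)" and "d \<equiv> rmem s ''Delta'' j"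
  shows "runs T f xs (clamp_prog a) s (\<lambda>t s'. t \<le> 80 \<and>
    s' = rwrite a k (max (c - d) (min (c + d) (rmem s a k))) s)"
proof -
  \<comment> \<open>The entry that supplies the centre must survive the write to entry
    \<open>k\<close>.\<close>
  have ne: "k - nmem s ''p'' j \<noteq> k" using assms(3,4) by linarith
  consider "rmem s a k < c - d" | "c + d < rmem s a k" | "c - d \<le> rmem s a k" "rmem s a k \<le> c + d"
    by linarith
  then show ?thesis
  proof cases
    case 1
    then show ?thesis using assms ne
      by (simp add: clamp_prog_def Let_def runs_simps rwrite_def)
  next
    case 2
    then show ?thesis using assms ne
      by (simp add: clamp_prog_def Let_def runs_simps rwrite_def)
  next
    case 3
    then show ?thesis using assms ne
      by (simp add: clamp_prog_def Let_def runs_simps rwrite_def)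
  qed
qed

section \<open>Dynamic programming over the subsets\<close>

definition bits :: "nat \<Rightarrow> nat set" where
  "bits k = {j. bit k j}"

definition db_at :: "('i \<times> 'r) list \<Rightarrow> nat set \<Rightarrow> ('i, 'r) database" where
  "db_at xs J = fmrestrict_set ((\<lambda>j. fst (xs ! j)) ` J) (fmap_of_list xs)"

lemma bits_0 [simp]: "bits 0 = {}"
  by (simp add: bits_def)

lemma bits_less: "k < 2 ^ n \<Longrightarrow> j \<in> bits k \<Longrightarrow> j < n"
  using bit_nat_imp_le[of k j] power_increasing[of n j "2 :: nat"] unfolding bits_def
  by (metis le_less_trans linorder_not_less mem_Collect_eq one_le_numeral)

lemma bits_empty_iff: "bits k = {} \<longleftrightarrow> k = 0"
  by (auto simp: bits_def bit_eq_iff)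

text \<open>Digit \<open>j\<close> is one, so subtracting \<open>2 ^ j\<close> clears it without a
  borrow.\<close>

lemma bits_minus_power: "j \<in> bits k \<Longrightarrow> bits (k - 2 ^ j) = bits k - {j}"
proof -
  assume j: "j \<in> bits k"
  have "k = set_bit j (unset_bit j k)"
    using j by (intro bit_eqI) (auto simp: bit_set_bit_iff bit_unset_bit_iff bits_def)
  also have "\<dots> = unset_bit j k + 2 ^ j"
    by (simp add: set_bit_eq bit_unset_bit_iff)
  finally have "k - 2 ^ j = unset_bit j k" by simp
  then show ?thesis by (auto simp: bits_def bit_unset_bit_iff)
qed

lemma bits_full: "bits (2 ^ n - 1) = {..<n}"
  unfolding bits_def mask_eq_exp_minus_1[symmetric] by (auto simp: bit_mask_iff)

lemma db_at_empty [simp]: "db_at xs {} = fmempty"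
  by (simp add: db_at_def)

lemma fmlookup_nth:
  "distinct (map fst xs) \<Longrightarrow> j < length xs \<Longrightarrow> fmlookup (fmap_of_list xs) (fst (xs ! j)) = Some (snd (xs ! j))"
  by (simp add: fmlookup_of_list map_of_eq_Some_iff)

lemma db_at_insert:
  assumes "distinct (map fst xs)" "j < length xs"
  shows "db_at xs (insert j J) = fmupd (fst (xs ! j)) (snd (xs ! j)) (db_at xs J)"
  by (rule fmap_ext) (auto simp: db_at_def fmlookup_nth[OF assms])

lemma fmdom'_fmap_of_list: "fmdom' (fmap_of_list xs) = (\<lambda>j. fst (xs ! j)) ` {..<length xs}"
  by (force simp: fmdom'_alt_def fset_of_list.rep_eq in_set_conv_nth)

lemma db_at_full: "db_at xs {..<length xs} = fmap_of_list xs"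
  unfolding db_at_def fmdom'_fmap_of_list[symmetric] by (rule fmrestrict_set_dom)

lemma fmdom'_db_at:
  "J \<subseteq> {..<length xs} \<Longrightarrow> fmdom' (db_at xs J) = (\<lambda>j. fst (xs ! j)) ` J"
  unfolding db_at_def fmdom'_restrict_set_precise fmdom'_fmap_of_list by blast

text \<open>Distinct individuals make positions and keys correspond one to one, so dropping a key
  removes a single position.\<close>

lemma fmdrop_db_at:
  assumes "distinct (map fst xs)" "J \<subseteq> {..<length xs}" "j \<in> J"
  shows "fmdrop (fst (xs ! j)) (db_at xs J) = db_at xs (J - {j})"
proof -
  have "inj_on (\<lambda>j. fst (xs ! j)) J"
    using assms(1,2) by (auto simp: inj_on_def distinct_conv_nth subset_eq)
  then have "(\<lambda>j. fst (xs ! j)) ` (J - {j}) = (\<lambda>j. fst (xs ! j)) ` J - {fst (xs ! j)}"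
    using assms(3) by (auto simp: inj_on_def)
  then show ?thesis by (simp add: db_at_def)
qed

lemma card_fmdom'_db_at:
  assumes "J \<subseteq> {..<length xs}"
  shows "card (fmdom' (db_at xs J)) \<le> length xs"
  using card_mono[OF _ assms] card_image_le[of J "\<lambda>j. fst (xs ! j)"] finite_subset[OF assms]
  by (simp add: fmdom'_db_at[OF assms])

section \<open>Filling the table for all subsets\<close>

context
  fixes T :: "nat \<Rightarrow> nat" and f :: "('i, 'r) database \<Rightarrow> real ^ 2" and \<Delta> :: "'i \<Rightarrow> real"
    and xs :: "('i \<times> 'r) list"
  assumes mono_T: "mono T" and \<Delta>: "\<And>i. 0 \<le> \<Delta> i" and distinct_xs: "distinct (map fst xs)"
begin

abbreviation (input) key :: "nat \<Rightarrow> 'i" where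
  "key j \<equiv> fst (xs ! j)"

definition value_at :: "nat \<Rightarrow> real ^ 2" where
  "value_at k = sens_preproc f \<Delta> (db_at xs (bits k))"

text \<open>The coordinate recursions transported to codes: removing an individual becomes
  subtracting a power of two.\<close>

lemma value_at_coords:
  assumes "k < 2 ^ length xs"
  shows "coord_sum (value_at k) = closest_point (\<Inter>j\<in>bits k. cball (coord_sum (value_at (k - 2 ^ j))) (\<Delta> (key j)))
      (coord_sum (f (db_at xs (bits k))))"
    and "coord_diff (value_at k) = closest_point (\<Inter>j\<in>bits k. cball (coord_diff (value_at (k - 2 ^ j))) (\<Delta> (key j)))
      (coord_diff (f (db_at xs (bits k))))"
    and "(\<Inter>j\<in>bits k. cball (coord_sum (value_at (k - 2 ^ j))) (\<Delta> (key j))) \<noteq> {}"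
    and "(\<Inter>j\<in>bits k. cball (coord_diff (value_at (k - 2 ^ j))) (\<Delta> (key j))) \<noteq> {}"
proof -
  let ?D = "db_at xs (bits k)"
  have sub: "bits k \<subseteq> {..<length xs}" using bits_less[OF assms] by blast
  have drop: "sens_preproc f \<Delta> (fmdrop (key j) ?D) = value_at (k - 2 ^ j)" if "j \<in> bits k" for j
    using fmdrop_db_at[OF distinct_xs sub that] bits_minus_power[OF that] by (simp add: value_at_def)
  have eq: "(\<Inter>i\<in>fmdom' ?D. cball (h (sens_preproc f \<Delta> (fmdrop i ?D))) (\<Delta> i)) =
      (\<Inter>j\<in>bits k. cball (h (value_at (k - 2 ^ j))) (\<Delta> (key j)))" for h :: "real ^ 2 \<Rightarrow> real"
    unfolding fmdom'_db_at[OF sub] image_image using drop by simp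
  have "(coord_sum (value_at k) = closest_point (\<Inter>j\<in>bits k. cball (coord_sum (value_at (k - 2 ^ j))) (\<Delta> (key j)))
      (coord_sum (f ?D))) \<and>
    (coord_diff (value_at k) = closest_point (\<Inter>j\<in>bits k. cball (coord_diff (value_at (k - 2 ^ j))) (\<Delta> (key j)))
      (coord_diff (f ?D))) \<and>
    (\<Inter>j\<in>bits k. cball (coord_sum (value_at (k - 2 ^ j))) (\<Delta> (key j))) \<noteq> {} \<and>
    (\<Inter>j\<in>bits k. cball (coord_diff (value_at (k - 2 ^ j))) (\<Delta> (key j))) \<noteq> {}"
  proof (cases "k = 0")
    case True
    \<comment> \<open>The empty intersection is the whole line, so the base case follows the same
      formula and the program needs no case distinction.\<close>
    then show ?thesis by (simp add: value_at_def closest_point_self)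
  next
    case False
    then have "fmdom' ?D \<noteq> {}" unfolding fmdom'_db_at[OF sub] by (simp add: bits_empty_iff)
    then have "?D \<noteq> fmempty" by simp
    from sens_preproc_coords[of \<Delta>, OF \<Delta> this, of f] show ?thesis
      unfolding eq value_at_def[of k, symmetric] by blast
  qed
  then show "coord_sum (value_at k) = closest_point (\<Inter>j\<in>bits k. cball (coord_sum (value_at (k - 2 ^ j))) (\<Delta> (key j)))
      (coord_sum (f (db_at xs (bits k))))"
    and "coord_diff (value_at k) = closest_point (\<Inter>j\<in>bits k. cball (coord_diff (value_at (k - 2 ^ j))) (\<Delta> (key j)))
      (coord_diff (f (db_at xs (bits k))))"
    and "(\<Inter>j\<in>bits k. cball (coord_sum (value_at (k - 2 ^ j))) (\<Delta> (key j))) \<noteq> {}"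
    and "(\<Inter>j\<in>bits k. cball (coord_diff (value_at (k - 2 ^ j))) (\<Delta> (key j))) \<noteq> {}"
    by blast+
qed

text \<open>The table is constrained only below \<open>k\<close>, so the invariant survives all
  writes to entry \<open>k\<close> while subset \<open>k\<close> is being processed.\<close>

definition table_inv :: "nat \<Rightarrow> ('i, 'r) state \<Rightarrow> bool" where
  "table_inv k s \<longleftrightarrow> nmem s ''n'' 0 = length xs \<and> nmem s ''m'' 0 = k \<and>
    (\<forall>j\<le>length xs. nmem s ''p'' j = 2 ^ j) \<and>
    (\<forall>j<length xs. rmem s ''Delta'' j = \<Delta> (key j)) \<and>
    (\<forall>l<k. rmem s ''u'' l = coord_sum (value_at l) \<and> rmem s ''v'' l = coord_diff (value_at l))"

lemma runs_insert_bits: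
  assumes "table_inv k s" "k < 2 ^ length xs" "buffer s = fmempty"
  shows "runs T f xs (for_bits_prog (InsertRecord (NVar ''i''))) s (\<lambda>t s'.
    t \<le> 50 * length xs + 20 \<and> table_inv k s' \<and> buffer s' = db_at xs (bits k))"
proof (rule runs_mono[OF runs_for_bits_prog[where n = "length xs" and k = k and C = 10
      and P = "\<lambda>J rm b. rm = rmem s \<and> b = db_at xs J"]])
  fix j J and s' :: "('i, 'r) state"
  assume j: "j < length xs" "nmem s' ''i'' 0 = j" and "rmem s' = rmem s \<and> buffer s' = db_at xs J"
  then show "runs T f xs (InsertRecord (NVar ''i'')) s' (\<lambda>t s''. t \<le> 10 \<and> nmem s'' = nmem s' \<and>
      rmem s'' = rmem s \<and> buffer s'' = db_at xs (insert j J))"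
    by (subst runs_InsertRecord[OF _ surjective_pairing]) (simp_all add: db_at_insert[OF distinct_xs])
qed (use assms in \<open>auto simp: table_inv_def bits_def\<close>)

text \<open>With the digits in \<open>J\<close> treated, entry \<open>k\<close> holds the projection
  onto the intervals of \<open>J\<close>: the coordinate of \<open>f\<close> for
  \<open>J = {}\<close>, that of \<open>g\<close> for \<open>J = bits k\<close>.\<close>

lemma runs_clamp_bits:
  assumes "table_inv k s" "k < 2 ^ length xs"
    and "rmem s ''u'' k = coord_sum (f (db_at xs (bits k)))" "rmem s ''v'' k = coord_diff (f (db_at xs (bits k)))"
  shows "runs T f xs (for_bits_prog (Seq (clamp_prog ''u'') (clamp_prog ''v''))) s (\<lambda>t s'.
    t \<le> 200 * length xs + 20 \<and> table_inv k s' \<and>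
    rmem s' ''u'' k = coord_sum (value_at k) \<and> rmem s' ''v'' k = coord_diff (value_at k))"
proof -
  let ?cp = "\<lambda>h J. closest_point (\<Inter>j\<in>J. cball (h (value_at (k - 2 ^ j))) (\<Delta> (key j))) (h (f (db_at xs (bits k)))) :: real"
  let ?P = "\<lambda>J (rm :: vname \<Rightarrow> nat \<Rightarrow> real) (b :: ('i, 'r) database). rm ''u'' k = ?cp coord_sum J \<and> rm ''v'' k = ?cp coord_diff J \<and>
    rm ''Delta'' = rmem s ''Delta'' \<and>
    (\<forall>l<k. rm ''u'' l = coord_sum (value_at l) \<and> rm ''v'' l = coord_diff (value_at l))"
  have "runs T f xs (for_bits_prog (Seq (clamp_prog ''u'') (clamp_prog ''v''))) s (\<lambda>t s'.
    t \<le> length xs * (160 + 40) + 20 \<and> (\<forall>v. v \<noteq> ''i'' \<and> v \<noteq> ''r'' \<longrightarrow> nmem s' v = nmem s v) \<and>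
    ?P {j. bit k j} (rmem s') (buffer s'))"
  proof (rule runs_for_bits_prog)
    fix j J and s' :: "('i, 'r) state"
    assume j: "j < length xs" "bit k j" "J \<subseteq> {j. bit k j}" "nmem s' ''i'' 0 = j"
      and P: "?P J (rmem s') (buffer s')"
      and frame: "\<And>v. v \<noteq> ''i'' \<Longrightarrow> v \<noteq> ''r'' \<Longrightarrow> nmem s' v = nmem s v"
    have le: "2 ^ j \<le> k" using j(2) by (rule bit_nat_imp_le)
    have nm: "nmem s' ''m'' 0 = k" "nmem s' ''p'' j = 2 ^ j" "rmem s' ''Delta'' j = \<Delta> (key j)"
      using frame assms(1) j P by (simp_all add: table_inv_def)
    \<comment> \<open>The centre is read from an entry that is already final.\<close>
    have lt: "k - 2 ^ j < k" by (rule diff_less[OF _ less_le_trans[OF _ le]]) simp_all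
    have ins: "insert j J \<subseteq> bits k" using j by (auto simp: bits_def)
    note step = closest_point_insert_cball[OF value_at_coords(3)[OF assms(2)] ins]
      closest_point_insert_cball[OF value_at_coords(4)[OF assms(2)] ins]
    let ?s1 = "rwrite ''u'' k (?cp coord_sum (insert j J)) s'"
    let ?s2 = "rwrite ''v'' k (?cp coord_diff (insert j J)) ?s1"
    have 1: "runs T f xs (clamp_prog ''u'') s' (\<lambda>t s''. t \<le> 80 \<and> s'' = ?s1)"
      by (rule runs_mono[OF runs_clamp_prog[where k = k and j = j]])
        (use j nm le lt P \<Delta> step in \<open>auto\<close>)
    have 2: "runs T f xs (clamp_prog ''v'') ?s1 (\<lambda>t s''. t \<le> 80 \<and> s'' = ?s2)"
      by (rule runs_mono[OF runs_clamp_prog[where k = k and j = j]])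
        (use j nm le lt P \<Delta> step in \<open>auto\<close>)
    have "?P (insert j J) (rmem ?s2) (buffer ?s2)" "nmem ?s2 = nmem s'"
      using P by (auto)
    then show "runs T f xs (Seq (clamp_prog ''u'') (clamp_prog ''v'')) s' (\<lambda>t s''. t \<le> 160 \<and>
        nmem s'' = nmem s' \<and> ?P (insert j J) (rmem s'') (buffer s''))"
      unfolding runs_Seq
      by (intro runs_mono[OF 1], elim conjE, hypsubst) (intro runs_mono[OF 2], auto)
  qed (use assms in \<open>auto simp: table_inv_def closest_point_self\<close>)
  then show ?thesis
    by (rule runs_mono)
      (use assms(1) value_at_coords(1,2)[OF assms(2)] in \<open>auto simp: table_inv_def bits_def\<close>)
qed

text \<open>The queried database has at most \<open>length xs\<close> records, so monotonicity of
  \<open>T\<close> bounds the query. The two digit scans account for \<open>50 + 200\<close> steps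
  per record.\<close>

lemma runs_subset_prog:
  assumes "table_inv k s" "k < 2 ^ length xs"
  shows "runs T f xs subset_prog s (\<lambda>t s'. t \<le> T (length xs) + 250 * length xs + 100 \<and> table_inv (Suc k) s')"
proof -
  let ?D = "db_at xs (bits k)"
  have "bits k \<subseteq> {..<length xs}" using bits_less[OF assms(2)] by blast
  from card_fmdom'_db_at[OF this] have Tle: "T (card (fmdom' ?D)) \<le> T (length xs)"
    using mono_T by (auto dest: monoD)
  have 1: "runs T f xs (for_bits_prog (InsertRecord (NVar ''i''))) (s\<lparr>buffer := fmempty\<rparr>) (\<lambda>t s'.
    t \<le> 50 * length xs + 20 \<and> table_inv k s' \<and> buffer s' = ?D)"
    using assms by (intro runs_insert_bits) (auto simp: table_inv_def)
  \<comment> \<open>The state after the query and the two writes, in the simplifier's normal form,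
    hence \<open>Suc 0\<close>.\<close>
  let ?next = "\<lambda>s'. rwrite ''v'' k (f ?D $ 1 - f ?D $ 2) (rwrite ''u'' k (f ?D $ 1 + f ?D $ 2)
    (rwrite ''q'' 0 (f ?D $ 1) (rwrite ''q'' (Suc 0) (f ?D $ 2) s')))"
  have 2: "runs T f xs (for_bits_prog (Seq (clamp_prog ''u'') (clamp_prog ''v''))) (?next s') (\<lambda>t s''.
    t \<le> 200 * length xs + 20 \<and> table_inv k s'' \<and>
    rmem s'' ''u'' k = coord_sum (value_at k) \<and> rmem s'' ''v'' k = coord_diff (value_at k))"
    if "table_inv k s'" for s'
    using that assms(2) by (intro runs_clamp_bits) (auto simp: table_inv_def coord_sum_def coord_diff_def)
  show ?thesis
    unfolding subset_prog_def runs_Seq runs_ClearBuffer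
  proof (rule runs_mono[OF 1], elim conjE)
    fix t s'
    assume t: "t \<le> 50 * length xs + 20" and s': "table_inv k s'" "buffer s' = ?D"
    then have m: "nmem s' ''m'' 0 = k" by (simp add: table_inv_def)
    show "runs T f xs (Query ''q'') s' (\<lambda>ta s''. runs T f xs (RWrite ''u'' (NVar ''m'') (RAdd (RRead ''q'' (NConst 0)) (RRead ''q'' (NConst 1)))) s''
        (\<lambda>tb s''. runs T f xs (RWrite ''v'' (NVar ''m'') (RSub (RRead ''q'' (NConst 0)) (RRead ''q'' (NConst 1)))) s''
        (\<lambda>tc s''. runs T f xs (for_bits_prog (Seq (clamp_prog ''u'') (clamp_prog ''v''))) s''
        (\<lambda>td s''. runs T f xs (NWrite ''m'' (NConst 0) (NAdd (NVar ''m'') (NConst 1))) s''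
        (\<lambda>te s''. 1 + (t + (ta + (tb + (tc + (td + te))))) \<le> T (length xs) + 250 * length xs + 100 \<and> table_inv (Suc k) s'')))))"
      unfolding runs_simps
      by (simp add: s'(2) m)
        (rule runs_mono[OF 2[OF s'(1)]], use t Tle in \<open>auto simp: runs_simps table_inv_def less_Suc_eq\<close>)
  qed
qed

lemma runs_sens_preproc_prog:
  "runs T f xs sens_preproc_prog (initial_state \<Delta> xs) (\<lambda>t s.
    t \<le> 500 * ((T (length xs) + length xs + 1) * 2 ^ length xs) \<and>
    rmem s ''out'' 0 = sens_preproc f \<Delta> (fmap_of_list xs) $ 1 \<and>
    rmem s ''out'' 1 = sens_preproc f \<Delta> (fmap_of_list xs) $ 2)"
proof -
  define n where "n = length xs"
  define C where "C = T n + 250 * n + 100"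
  let ?b = "NLess (NVar ''m'') (NRead ''p'' (NVar ''n''))"
  have 1: "runs T f xs powers_prog (initial_state \<Delta> xs) (\<lambda>t s. t \<le> 40 * n + 40 \<and> table_inv 0 s)"
    by (rule runs_mono[OF runs_powers_prog[of _ n]])
      (auto simp: n_def initial_state_def table_inv_def)
  have 2: "runs T f xs (While ?b subset_prog) s (\<lambda>t s'. t \<le> 2 ^ n * (1 + bcost ?b + C) + (1 + bcost ?b) \<and>
      table_inv (2 ^ n) s')" if "table_inv 0 s" for s
    by (rule runs_While, rule that)
      (use runs_subset_prog in \<open>auto simp: table_inv_def n_def C_def\<close>)
  have full: "value_at (2 ^ n - 1) = sens_preproc f \<Delta> (fmap_of_list xs)"
    by (simp only: value_at_def bits_full n_def db_at_full)
  \<comment> \<open>Here \<open>t\<close>, \<open>u\<close> and \<open>w\<close> stand for the times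
    of the power table, the main loop and the output. The summand \<open>1\<close> covers constant
    costs even if \<open>T n + n = 0\<close>.\<close>
  have time: "t + (u + w) \<le> 500 * ((T n + n + 1) * 2 ^ n)"
    if "t \<le> 40 * n + 40" "u \<le> 2 ^ n * (1 + bcost ?b + C) + (1 + bcost ?b)" "w \<le> 100" for t u w
  proof -
    have "(1 :: nat) \<le> 2 ^ n" by simp
    then have "40 * n + 200 \<le> (40 * n + 200) * 2 ^ n" by simp
    moreover have "u \<le> 2 ^ n * (10 + C) + 10"
    proof -
      have "bcost ?b = 6" by simp
      with that(2) have "u \<le> 2 ^ n * (1 + 6 + C) + (1 + 6)" by (simp only:)
      also have "\<dots> \<le> 2 ^ n * (10 + C) + 10" by (intro add_mono mult_le_mono2) simp_all
      finally show ?thesis .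
    qed
    then have "t + (u + w) \<le> 2 ^ n * (10 + C) + (40 * n + 200)" using that(1,3) by linarith
    ultimately have "t + (u + w) \<le> (10 + C + 40 * n + 200) * 2 ^ n" by (simp add: algebra_simps)
    also have "\<dots> \<le> (500 * (T n + n + 1)) * 2 ^ n" by (intro mult_right_mono) (simp_all add: C_def)
    finally show ?thesis by (simp only: mult.assoc)
  qed
  show ?thesis
    unfolding sens_preproc_prog_def Let_def runs_Seq
    apply (rule runs_mono[OF 1], elim conjE)
    apply (rule runs_mono[OF 2], assumption, elim conjE)
    unfolding runs_simps n_def[symmetric] full[symmetric]
    subgoal for t s u s'
      using time[of t u 100] by (auto simp: table_inv_def coord_sum_def coord_diff_def)
    done
qed

end

section \<open>The asymptotic running time, combined with the sensitivity and error bounds\<close>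

theorem theorem8p3:
  shows
    "(\<exists>p. \<forall>T :: nat \<Rightarrow> nat. mono T \<longrightarrow>
        (\<exists>t :: nat \<Rightarrow> nat. (\<lambda>n. real (t n)) \<in> O(\<lambda>n. (real (T n) + real n) * 2 ^ n) \<and>
          (\<forall>(U :: ('i, 'r) database set) (f :: ('i, 'r) database \<Rightarrow> real ^ 2) (\<Delta> :: 'i \<Rightarrow> real) xs.
             data_universe U \<longrightarrow> (\<forall>i. 0 \<le> \<Delta> i) \<longrightarrow>
             distinct (map fst xs) \<longrightarrow> fmap_of_list xs \<in> U \<longrightarrow>
             computes_within T f \<Delta> p xs (sens_preproc f \<Delta> (fmap_of_list xs)) (t (length xs)))))
     \<and>
     (\<forall>(U :: ('i, 'r) database set) (f :: ('i, 'r) database \<Rightarrow> real ^ 2) (\<Delta> :: 'i \<Rightarrow> real).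
        data_universe U \<longrightarrow> (\<forall>i. 0 \<le> \<Delta> i) \<longrightarrow>
        (\<forall>i. sensitivity U (sens_preproc f \<Delta>) i \<le> ennreal (\<Delta> i)) \<and>
        (\<forall>xs. distinct (map fst xs) \<longrightarrow> fmap_of_list xs \<in> U \<longrightarrow>
           l1norm (f (fmap_of_list xs) - sens_preproc f \<Delta> (fmap_of_list xs))
             \<le> Max (path_error f \<Delta> xs ` {\<sigma>. \<sigma> permutes {..<length xs}})))"
proof (rule conjI)
  show "\<exists>p. \<forall>T :: nat \<Rightarrow> nat. mono T \<longrightarrow>
        (\<exists>t :: nat \<Rightarrow> nat. (\<lambda>n. real (t n)) \<in> O(\<lambda>n. (real (T n) + real n) * 2 ^ n) \<and>
          (\<forall>(U :: ('i, 'r) database set) (f :: ('i, 'r) database \<Rightarrow> real ^ 2) (\<Delta> :: 'i \<Rightarrow> real) xs.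
             data_universe U \<longrightarrow> (\<forall>i. 0 \<le> \<Delta> i) \<longrightarrow>
             distinct (map fst xs) \<longrightarrow> fmap_of_list xs \<in> U \<longrightarrow>
             computes_within T f \<Delta> p xs (sens_preproc f \<Delta> (fmap_of_list xs)) (t (length xs))))"
  proof (intro exI[of _ sens_preproc_prog] allI impI)
    fix T :: "nat \<Rightarrow> nat" assume "mono T"
    let ?t = "\<lambda>n. 500 * ((T n + n + 1) * 2 ^ n)"
    have "(\<lambda>n. real (?t n)) \<in> O(\<lambda>n. (real (T n) + real n) * 2 ^ n)"
    proof (rule bigoI[of _ 1000], rule eventually_sequentiallyI)
      \<comment> \<open>From \<open>n = 1\<close> on, the summand \<open>1\<close> is at most
        \<open>n\<close>, so doubling the constant absorbs it.\<close>
      fix n :: nat assume "1 \<le> n"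
      then have "500 * (real (T n) + real n + 1) * 2 ^ n \<le> 1000 * (real (T n) + real n) * 2 ^ n"
        by (intro mult_right_mono) simp_all
      then show "norm (real (?t n)) \<le> 1000 * norm ((real (T n) + real n) * 2 ^ n)"
        by (simp add: algebra_simps)
    qed
    moreover have "computes_within T f \<Delta> sens_preproc_prog xs (sens_preproc f \<Delta> (fmap_of_list xs)) (?t (length xs))"
      if "\<forall>i. 0 \<le> \<Delta> i" "distinct (map fst xs)"
      for f :: "('i, 'r) database \<Rightarrow> real ^ 2" and \<Delta> xs
      using runs_sens_preproc_prog[OF \<open>mono T\<close>, of \<Delta> xs f] that
      unfolding computes_within_def runs_def by blast
    ultimately show "\<exists>t :: nat \<Rightarrow> nat. (\<lambda>n. real (t n)) \<in> O(\<lambda>n. (real (T n) + real n) * 2 ^ n) \<and>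
          (\<forall>(U :: ('i, 'r) database set) (f :: ('i, 'r) database \<Rightarrow> real ^ 2) (\<Delta> :: 'i \<Rightarrow> real) xs.
             data_universe U \<longrightarrow> (\<forall>i. 0 \<le> \<Delta> i) \<longrightarrow>
             distinct (map fst xs) \<longrightarrow> fmap_of_list xs \<in> U \<longrightarrow>
             computes_within T f \<Delta> sens_preproc_prog xs (sens_preproc f \<Delta> (fmap_of_list xs)) (t (length xs)))"
      by (intro exI[of _ ?t]) blast
  qed
qed (intro allI impI conjI sensitivity_sens_preproc sens_preproc_error_Max; blast)

end
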